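(* For every $\varepsilon>0$ there exists $n_0$ such that the following holds for all $n\ge n_0$ and all $d\ge 2$. Consider an evolution, on the time interval $(-\infty,\infty)$, of $n$ hard balls in $\mathbb{R}^d$ of equal masses and radii $1$, colliding elastically, with no simultaneous collisions. Suppose that at the time of a collision of any two balls, the distance between any other pair of balls is greater than $n^{-n}$. Then the total number of collisions is bounded by $n^{5n/2+\varepsilon n}$.
   Context: Hard ball dynamics: $n$ balls in $\mathbb{R}^d$ have radius $1$ and equal masses. The centers $x^k(t)$ are continuous functions of $t\in\mathbb{R}$ with $|x^j(t)-x^k(t)|\ge 2$ for $j\ne k$ (balls do not overlap), and velocities $v^k$ are constant between collisions. Balls $j$ and $k$ collide at time $t$ if $|x^j(t)-x^k(t)|=2$ and their velocities change at time $t$. In that case the velocities just before the collision satisfy $(v^j(t-)-v^k(t-))\cdot(x^j(t)-x^k(t))<0$ and, with $x^{jk}(t)=(x^j(t)-x^k(t))/|x^j(t)-x^k(t)|$, $$v^j(t+)=v^j(t-)+(v^k(t-)\cdot x^{jk}(t))x^{jk}(t)-(v^j(t-)\cdot x^{jk}(t))x^{jk}(t),$$ $$v^k(t+)=v^k(t-)+(v^j(t-)\cdot x^{jk}(t))x^{jk}(t)-(v^k(t-)\cdot x^{jk}(t))x^{jk}(t).$$ The velocity of a ball changes only at its collisions. No simultaneous collisions: there is no time $t$ and no collection of at least three balls such that any two balls of the collection are linked by a chain of balls in which consecutive balls are in contact at time $t$. Consequently there are only finitely many collisions in every finite time interval. The distance between balls $B_j$ and $B_k$ is the distance between them as sets,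 i.e. $|x^j(t)-x^k(t)|-2$. "Any other pair" means any pair of balls other than the colliding pair (it may share one ball with the colliding pair). *)

theory Defs
  imports "HOL-Analysis.Analysis"
begin

text \<open>
  The dimension \<open>d\<close> is quantified inside the main statement (the threshold on the number of
  balls must not depend on it), so a vector of \<open>d\<close>-dimensional Euclidean space is a function
  \<open>nat \<Rightarrow> real\<close> of which only the coordinates \<open>i < d\<close> are ever used. The number \<open>x k t i\<close> is the
  \<open>i\<close>-th coordinate of the centre of ball \<open>k\<close> at time \<open>t\<close>; the \<open>n\<close> balls are \<open>0, \<dots>, n - 1\<close>.
\<close>

type_synonym motion = "nat \<Rightarrow> real \<Rightarrow> nat \<Rightarrow> real"

definition dot :: "nat \<Rightarrow> (nat \<Rightarrow> real) \<Rightarrow> (nat \<Rightarrow> real) \<Rightarrow> real" where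
  "dot d u w = (\<Sum>i<d. u i * w i)"

definition centre_dist :: "nat \<Rightarrow> motion \<Rightarrow> nat \<Rightarrow> nat \<Rightarrow> real \<Rightarrow> real" where
  "centre_dist d x j k t = L2_set (\<lambda>i. x j t i - x k t i) {..<d}"

definition ball_dist :: "nat \<Rightarrow> motion \<Rightarrow> nat \<Rightarrow> nat \<Rightarrow> real \<Rightarrow> real" where
  "ball_dist d x j k t = centre_dist d x j k t - 2"

definition in_contact :: "nat \<Rightarrow> motion \<Rightarrow> nat \<Rightarrow> nat \<Rightarrow> real \<Rightarrow> bool" where
  "in_contact d x j k t \<longleftrightarrow> centre_dist d x j k t = 2"

text \<open>
  The velocities just before and just after time \<open>t\<close> are the one-sided derivatives of the position;
  their existence is part of \<open>hard_ball_evolution\<close> below.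
\<close>

definition vel_before :: "motion \<Rightarrow> nat \<Rightarrow> real \<Rightarrow> nat \<Rightarrow> real" where
  "vel_before x k t i = vector_derivative (\<lambda>s. x k s i) (at_left t)"

definition vel_after :: "motion \<Rightarrow> nat \<Rightarrow> real \<Rightarrow> nat \<Rightarrow> real" where
  "vel_after x k t i = vector_derivative (\<lambda>s. x k s i) (at_right t)"

definition vel_changes :: "nat \<Rightarrow> motion \<Rightarrow> nat \<Rightarrow> real \<Rightarrow> bool" where
  "vel_changes d x k t \<longleftrightarrow> (\<exists>i<d. vel_before x k t i \<noteq> vel_after x k t i)"

definition collide :: "nat \<Rightarrow> motion \<Rightarrow> nat \<Rightarrow> nat \<Rightarrow> real \<Rightarrow> bool" where
  "collide d x j k t \<longleftrightarrow> in_contact d x j k t \<and> vel_changes d x j t \<and> vel_changes d x k t"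

definition elastic_law :: "nat \<Rightarrow> motion \<Rightarrow> nat \<Rightarrow> nat \<Rightarrow> real \<Rightarrow> bool" where
  "elastic_law d x j k t \<longleftrightarrow>
    (let e = (\<lambda>i. (x j t i - x k t i) / centre_dist d x j k t);
         vj = vel_before x j t;
         vk = vel_before x k t
     in dot d (\<lambda>i. vj i - vk i) (\<lambda>i. x j t i - x k t i) < 0 \<and>
        (\<forall>i<d. vel_after x j t i = vj i + dot d vk e * e i - dot d vj e * e i) \<and>
        (\<forall>i<d. vel_after x k t i = vk i + dot d vj e * e i - dot d vk e * e i))"

definition hard_ball_evolution :: "nat \<Rightarrow> nat \<Rightarrow> motion \<Rightarrow> bool" where
  "hard_ball_evolution n d x \<longleftrightarrow>
    (\<forall>k<n. \<forall>i<d. continuous_on UNIV (\<lambda>t. x k t i)) \<and>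
    (\<forall>j<n. \<forall>k<n. j \<noteq> k \<longrightarrow> (\<forall>t. centre_dist d x j k t \<ge> 2)) \<and>
    (\<forall>k<n. \<forall>t. \<forall>i<d. (\<lambda>s. x k s i) differentiable at_left t \<and>
                        (\<lambda>s. x k s i) differentiable at_right t) \<and>
    (\<forall>k<n. \<forall>a b. a < b \<longrightarrow> (\<forall>t\<in>{a<..<b}. \<forall>j<n. \<not> collide d x j k t) \<longrightarrow>
       (\<exists>u. \<forall>t\<in>{a<..<b}. \<forall>i<d. ((\<lambda>s. x k s i) has_real_derivative u i) (at t))) \<and>
    (\<forall>j<n. \<forall>k<n. \<forall>t. collide d x j k t \<longrightarrow> elastic_law d x j k t)"

definition no_simultaneous_collisions :: "nat \<Rightarrow> nat \<Rightarrow> motion \<Rightarrow> bool" where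
  "no_simultaneous_collisions n d x \<longleftrightarrow>
    \<not> (\<exists>t. \<exists>S\<subseteq>{..<n}. card S \<ge> 3 \<and>
         (\<forall>j\<in>S. \<forall>k\<in>S. (j, k) \<in> {(a, b). a < n \<and> b < n \<and> in_contact d x a b t}\<^sup>*))"

text \<open>Ordering the pair by \<open>j < k\<close> counts each collision once.\<close>

definition collisions :: "nat \<Rightarrow> nat \<Rightarrow> motion \<Rightarrow> (nat \<times> nat \<times> real) set" where
  "collisions n d x = {(j, k, t). j < k \<and> k < n \<and> collide d x j k t}"

end

theory Submission imports Defs begin

text \<open>
  Let \<open>S\<close> be a set of \<open>m\<close> balls not colliding with the others during some time interval, let \<open>Z\<close> be its
  configuration relative to the centre of mass and \<open>W\<close> the velocity of \<open>Z\<close>. The energy \<open>|W|^2 = r^2\<close> is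
  constant and \<open>Z \<cdot> W\<close> jumps up at each collision. Let \<open>R\<close> be the minimum of \<open>|Z|\<close>, attained at \<open>t0\<close>. For
  \<open>t \<ge> t0\<close> one gets \<open>|Z|^2 \<ge> R^2 + r^2 (t - t0)^2\<close>, while \<open>r^2 |Z|^2 - (Z \<cdot> W)^2\<close> does not increase, so that
  the normalised configuration \<open>Z / |Z|\<close> moves on the unit sphere with speed at most that of a point on a
  straight line at distance \<open>R\<close>: its path has bounded total length, and the same holds backwards in time.
  A normalised configuration always splits into two groups at a distance of order \<open>m^(- 3/2)\<close>. As
  long as \<open>|Z|\<close> is at least of order \<open>m^(3/2)\<close>, the two groups cannot touch before the normalised configuration has
  moved by an amount of order \<open>m^(- 3/2)\<close>. Hence all such times are covered by \<open>O(m^(3/2))\<close> windows, in each of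
  which \<open>S\<close> falls apart into two smaller non-interacting systems. The remaining times form an interval of
  length \<open>O(m^(3/2) / r)\<close>, in which the collisions are separated by times of order \<open>\<delta> / r\<close>, where \<open>\<delta> = n^(- n)\<close>.
  So the maximal number of collisions satisfies \<open>K m \<le> O(m^(3/2) / \<delta>) + O(m^(3/2)) * K (m - 1)\<close>, and
  \<open>K n\<close> is at most \<open>n^n * n^(3n/2)\<close> up to a factor \<open>n^(o(n))\<close>.
\<close>

section \<open>Broken lines that are pushed outwards\<close>

definition ip :: "'i set \<Rightarrow> ('i \<Rightarrow> real) \<Rightarrow> ('i \<Rightarrow> real) \<Rightarrow> real" where
  "ip I f g = (\<Sum>i\<in>I. f i * g i)"

lemma ip_commute: "ip I f g = ip I g f"
  by (simp add: ip_def mult.commute)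

lemma ip_cong: "(\<And>i. i \<in> I \<Longrightarrow> f i = f' i) \<Longrightarrow> (\<And>i. i \<in> I \<Longrightarrow> g i = g' i) \<Longrightarrow> ip I f g = ip I f' g'"
  by (simp add: ip_def)

lemma ip_self_nonneg: "0 \<le> ip I f f"
  by (simp add: ip_def sum_nonneg)

lemma ip_Cauchy_Schwarz: "(ip I f g)\<^sup>2 \<le> ip I f f * ip I g g"
  using Cauchy_Schwarz_ineq_sum[of f g I] by (simp add: ip_def power2_eq_square)

lemma ip_lin_right: "ip I f (\<lambda>i. a * g i + b * h i) = a * ip I f g + b * ip I f h"
  by (simp add: ip_def sum.distrib sum_distrib_left algebra_simps)

lemma ip_add_scaled_right: "ip I f (\<lambda>i. g i + s * h i) = ip I f g + s * ip I f h"
  using ip_lin_right[of I f 1 g s h] by simp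

lemma ip_lin_self:
  "ip I (\<lambda>i. a * g i + b * h i) (\<lambda>i. a * g i + b * h i)
    = a\<^sup>2 * ip I g g + 2 * a * b * ip I g h + b\<^sup>2 * ip I h h"
proof -
  have "ip I (\<lambda>i. a * g i + b * h i) (\<lambda>i. a * g i + b * h i)
    = a * ip I g (\<lambda>i. a * g i + b * h i) + b * ip I h (\<lambda>i. a * g i + b * h i)"
    by (simp only: ip_lin_right ip_commute[of I "\<lambda>i. a * g i + b * h i" g]
        ip_commute[of I "\<lambda>i. a * g i + b * h i" h] ip_lin_right[of I "\<lambda>i. a * g i + b * h i"])
  then show ?thesis
    unfolding ip_lin_right ip_commute[of I h g] by (simp add: algebra_simps power2_eq_square)
qed

lemma ip_line:
  "ip I (\<lambda>i. f i + s * g i) (\<lambda>i. f i + s * g i) = ip I f f + 2 * s * ip I f g + s\<^sup>2 * ip I g g"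
  using ip_lin_self[of I 1 f s g] by simp

text \<open>With \<open>u = r * s / R\<close>, \<open>turn R r s = 2 * u / (1 + u)\<close> is a rational substitute for the angle
  \<open>arctan u\<close> seen from distance \<open>R\<close> by a point at speed \<open>r\<close>: its derivative dominates that of \<open>arctan u\<close>,
  and it stays below \<open>2\<close>.\<close>

definition turn :: "real \<Rightarrow> real \<Rightarrow> real \<Rightarrow> real" where
  "turn R r s = 2 * (r * s) / (R + r * s)"

lemma turn_deriv:
  assumes "0 < R" "0 < r" "0 \<le> s"
  shows "(turn R r has_real_derivative 2 * r * R / (R + r * s)\<^sup>2) (at s)"
proof -
  have "R + r * s > 0" using assms by (simp add: add_pos_nonneg)
  then show ?thesis
    unfolding turn_def
    by (auto intro!: derivative_eq_intros simp: field_simps power2_eq_square)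
qed

lemma turn_mono:
  assumes "0 < R" "0 < r" "0 \<le> s" "s \<le> s'"
  shows "turn R r s \<le> turn R r s'"
proof -
  have "R + r * s > 0" "R + r * s' > 0" using assms by (simp_all add: add_pos_nonneg)
  moreover have "R * (r * s) \<le> R * (r * s')" using assms by simp
  ultimately show ?thesis unfolding turn_def
    by (simp add: divide_simps) (simp add: algebra_simps)
qed

lemma turn_bounds:
  assumes "0 < R" "0 < r" "0 \<le> s"
  shows "0 \<le> turn R r s" "turn R r s \<le> 2"
proof -
  have "R + r * s > 0" using assms by (simp add: add_pos_nonneg)
  then show "0 \<le> turn R r s" "turn R r s \<le> 2" using assms
    unfolding turn_def by (auto simp: divide_simps)
qed

text \<open>The derivative of \<open>h\<close> is \<open>ip I w u / (q * sqrt q)\<close>, where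
  \<open>u\<close> is \<open>q\<close> times the part of the velocity orthogonal to the position
  \<open>f + s * g\<close>. Cauchy-Schwarz and the bound on the Gram determinant of position and
  velocity make it at most \<open>sqrt (ip I w w) * (r * R / q)\<close>, and the growth of
  \<open>q\<close> puts this below the derivative of \<open>turn\<close>. An arbitrary test vector
  \<open>w\<close> stands in for arc length on the sphere.\<close>

lemma line_turning:
  fixes f g w :: "'i \<Rightarrow> real"
  assumes L: "0 \<le> L" and sg: "0 \<le> \<sigma>" and R: "0 < R" and r: "0 < r"
    and gg: "ip I g g = r\<^sup>2"
    and D: "r\<^sup>2 * ip I f f - (ip I f g)\<^sup>2 \<le> (r * R)\<^sup>2"
    and low: "\<And>s. 0 \<le> s \<Longrightarrow> s \<le> L \<Longrightarrow>
        R\<^sup>2 + (r * (\<sigma> + s))\<^sup>2 \<le> ip I (\<lambda>i. f i + s * g i) (\<lambda>i. f i + s * g i)"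
  defines "h \<equiv> \<lambda>s. ip I w (\<lambda>i. f i + s * g i) / sqrt (ip I (\<lambda>i. f i + s * g i) (\<lambda>i. f i + s * g i))"
  shows "\<bar>h L - h 0\<bar> \<le> sqrt (ip I w w) * (turn R r (\<sigma> + L) - turn R r \<sigma>)"
proof -
  define ff fg wf wg ww where "ff = ip I f f" and "fg = ip I f g"
    and "wf = ip I w f" and "wg = ip I w g" and "ww = ip I w w"
  define q where "q s = ff + 2 * s * fg + s\<^sup>2 * r\<^sup>2" for s
  have q: "ip I (\<lambda>i. f i + s * g i) (\<lambda>i. f i + s * g i) = q s" for s
    unfolding ip_line q_def gg ff_def fg_def by simp
  have h: "h s = (wf + s * wg) / sqrt (q s)" for s
    unfolding h_def q unfolding ip_add_scaled_right wf_def wg_def by simp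
  define h' where "h' s = (q s * wg - (fg + s * r\<^sup>2) * (wf + s * wg)) / (q s * sqrt (q s))" for s
  have qlow: "R\<^sup>2 + (r * (\<sigma> + s))\<^sup>2 \<le> q s" if "0 \<le> s" "s \<le> L" for s
    using low[OF that] by (simp add: q)
  have qpos: "0 < q s" if "0 \<le> s" "s \<le> L" for s
    using qlow[OF that] R by (smt (verit) zero_le_power2 zero_less_power)
  have ww0: "0 \<le> ww" by (simp add: ww_def ip_self_nonneg)
  have hd: "(h has_real_derivative h' s) (at s)" if s: "0 \<le> s" "s \<le> L" for s
  proof -
    have hh: "h = (\<lambda>s. (wf + s * wg) / sqrt (q s))" using h by auto
    have qd: "(q has_real_derivative 2 * (fg + s * r\<^sup>2)) (at s)"
      unfolding q_def by (auto intro!: derivative_eq_intros simp: algebra_simps)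
    have sd: "((\<lambda>s. sqrt (q s)) has_real_derivative (fg + s * r\<^sup>2) / sqrt (q s)) (at s)"
    proof -
      have "((\<lambda>s. sqrt (q s)) has_real_derivative inverse (sqrt (q s)) / 2 * (2 * (fg + s * r\<^sup>2))) (at s)"
        by (rule DERIV_chain2[OF DERIV_real_sqrt[OF qpos[OF s]] qd])
      moreover have "inverse x / 2 * (2 * y) = y / x" for x y :: real
        by (simp add: field_simps)
      ultimately show ?thesis by metis
    qed
    have sq: "sqrt (q s) * sqrt (q s) = q s" using qpos[OF s] by simp
    have "(h has_real_derivative (wg * sqrt (q s) - (wf + s * wg) * ((fg + s * r\<^sup>2) / sqrt (q s)))
        / (sqrt (q s) * sqrt (q s))) (at s)"
      unfolding hh using qpos[OF s]
      by (intro DERIV_divide sd) (auto intro!: derivative_eq_intros)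
    moreover have "(wg * sqrt (q s) - (wf + s * wg) * ((fg + s * r\<^sup>2) / sqrt (q s)))
        / (sqrt (q s) * sqrt (q s)) = h' s"
    proof -
      have "wg * sqrt (q s) - (wf + s * wg) * ((fg + s * r\<^sup>2) / sqrt (q s)) =
         (q s * wg - (fg + s * r\<^sup>2) * (wf + s * wg)) / sqrt (q s)"
        using qpos[OF s] sq by (simp add: field_simps)
      then show ?thesis unfolding h'_def sq by simp
    qed
    ultimately show ?thesis by simp
  qed
  have hb: "\<bar>h' s\<bar> \<le> sqrt ww * (2 * r * R / (R + r * (\<sigma> + s))\<^sup>2)" if s: "0 \<le> s" "s \<le> L" for s
  proof -
    define u where "u i = q s * g i + (- (fg + s * r\<^sup>2)) * (f i + s * g i)" for i
    have wu: "ip I w u = q s * wg - (fg + s * r\<^sup>2) * (wf + s * wg)"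
      unfolding u_def ip_lin_right by (simp add: ip_add_scaled_right wg_def wf_def algebra_simps)
    have e: "ip I u u = (q s)\<^sup>2 * r\<^sup>2 - 2 * q s * (fg + s * r\<^sup>2)\<^sup>2 + (fg + s * r\<^sup>2)\<^sup>2 * q s"
    proof -
      have "ip I u u = ip I (\<lambda>i. q s * g i + (- (fg + s * r\<^sup>2)) * (f i + s * g i))
           (\<lambda>i. q s * g i + (- (fg + s * r\<^sup>2)) * (f i + s * g i))" by (simp add: u_def[abs_def])
      also have "\<dots> = (q s)\<^sup>2 * ip I g g - 2 * q s * (fg + s * r\<^sup>2) * ip I g (\<lambda>i. f i + s * g i)
          + (fg + s * r\<^sup>2)\<^sup>2 * ip I (\<lambda>i. f i + s * g i) (\<lambda>i. f i + s * g i)"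
        unfolding ip_lin_self unfolding power2_minus mult_minus_right mult_minus_left by simp
      also have "\<dots> = (q s)\<^sup>2 * r\<^sup>2 - 2 * q s * (fg + s * r\<^sup>2)\<^sup>2 + (fg + s * r\<^sup>2)\<^sup>2 * q s"
        unfolding q unfolding ip_add_scaled_right gg ip_commute[of I g f] fg_def by (simp add: power2_eq_square)
      finally show ?thesis .
    qed
    \<comment> \<open>The Gram determinant of position and velocity does not change along a straight
      line, so \<open>D\<close> at the start bounds it at every \<open>s\<close>.\<close>
    have "r\<^sup>2 * q s - (fg + s * r\<^sup>2)\<^sup>2 = r\<^sup>2 * ff - fg\<^sup>2"
      by (simp add: q_def algebra_simps power2_eq_square)
    then have D': "r\<^sup>2 * q s - (fg + s * r\<^sup>2)\<^sup>2 \<le> (r * R)\<^sup>2" using D by (simp add: ff_def fg_def)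
    have "ip I u u = q s * (r\<^sup>2 * q s - (fg + s * r\<^sup>2)\<^sup>2)"
      unfolding e by (simp add: algebra_simps power2_eq_square)
    also have "\<dots> \<le> q s * (r * R)\<^sup>2" using D' qpos[OF s] by simp
    finally have uu: "ip I u u \<le> q s * (r * R)\<^sup>2" .
    have c1: "(ip I w u)\<^sup>2 \<le> ww * ip I u u" unfolding ww_def by (rule ip_Cauchy_Schwarz)
    have c2: "ww * ip I u u \<le> ww * (q s * (r * R)\<^sup>2)" using uu ww0 by (rule mult_left_mono)
    have c3: "ww * (q s * (r * R)\<^sup>2) = (sqrt ww * (sqrt (q s) * (r * R)))\<^sup>2"
      using ww0 qpos[OF s] by (simp add: power_mult_distrib)
    have c4: "0 \<le> sqrt ww * (sqrt (q s) * (r * R))"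
      using R r ww0 qpos[OF s] by simp
    have "\<bar>ip I w u\<bar>\<^sup>2 \<le> (sqrt ww * (sqrt (q s) * (r * R)))\<^sup>2"
      unfolding power2_abs using c1 c2 c3 by linarith
    then have "\<bar>ip I w u\<bar> \<le> sqrt ww * (sqrt (q s) * (r * R))"
      using c4 by (rule power2_le_imp_le)
    then have "\<bar>ip I w u\<bar> / (q s * sqrt (q s)) \<le> sqrt ww * (sqrt (q s) * (r * R)) / (q s * sqrt (q s))"
      by (rule divide_right_mono) (use qpos[OF s] in simp)
    moreover have "\<bar>h' s\<bar> = \<bar>ip I w u\<bar> / (q s * sqrt (q s))"
      unfolding h'_def wu abs_divide using qpos[OF s] by simp
    ultimately have "\<bar>h' s\<bar> \<le> sqrt ww * (sqrt (q s) * (r * R)) / (q s * sqrt (q s))"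
      by simp
    also have "\<dots> = sqrt ww * (r * R / q s)" using qpos[OF s] by simp
    also have "\<dots> \<le> sqrt ww * (2 * r * R / (R + r * (\<sigma> + s))\<^sup>2)"
    proof (rule mult_left_mono)
      \<comment> \<open>The factor 2 in \<open>turn\<close> pays for
        \<open>(R + y)\<^sup>2 \<le> 2 * (R\<^sup>2 + y\<^sup>2)\<close>, which turns the bound into
        the derivative of a rational function.\<close>
      define y where "y = r * (\<sigma> + s)"
      have y: "0 \<le> y" using r sg s by (simp add: y_def)
      have "(R + y)\<^sup>2 \<le> 2 * (R\<^sup>2 + y\<^sup>2)"
        using zero_le_power2[of "R - y"] by (simp add: power2_eq_square algebra_simps)
      also have "\<dots> \<le> 2 * q s" using qlow[OF s] by (simp add: y_def)
      finally have le: "(R + y)\<^sup>2 \<le> 2 * q s" .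
      have "r * R / q s = 2 * r * R / (2 * q s)" by simp
      also have "\<dots> \<le> 2 * r * R / (R + y)\<^sup>2"
        using le R r y by (intro divide_left_mono) (auto intro!: mult_pos_pos simp: qpos[OF s])
      finally show "r * R / q s \<le> 2 * r * R / (R + r * (\<sigma> + s))\<^sup>2" by (simp add: y_def)
    qed (simp add: ww0)
    finally show ?thesis .
  qed
  have td: "((\<lambda>s. sqrt ww * turn R r (\<sigma> + s)) has_real_derivative
     sqrt ww * (2 * r * R / (R + r * (\<sigma> + s))\<^sup>2)) (at s)" if s: "0 \<le> s" "s \<le> L" for s
  proof -
    have "((\<lambda>s. turn R r (\<sigma> + s)) has_real_derivative (2 * r * R / (R + r * (\<sigma> + s))\<^sup>2)) (at s)"
      using turn_deriv[OF R r, of "s + \<sigma>"] sg s DERIV_shift[of "turn R r" _ s \<sigma>]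
      by (simp add: add.commute)
    then show ?thesis by (rule DERIV_cmult)
  qed
  \<comment> \<open>Instead of integrating the bound on \<open>h'\<close>, the scaled
    \<open>turn\<close> minus \<open>h\<close> and plus \<open>h\<close> are both shown to be
    nondecreasing.\<close>
  have "sqrt ww * turn R r (\<sigma> + 0) - h 0 \<le> sqrt ww * turn R r (\<sigma> + L) - h L"
  proof (rule DERIV_nonneg_imp_nondecreasing[OF L])
    fix s assume s: "0 \<le> s" "s \<le> L"
    show "\<exists>y. ((\<lambda>s. sqrt ww * turn R r (\<sigma> + s) - h s) has_real_derivative y) (at s) \<and> 0 \<le> y"
      using hb[OF s] by (intro exI[of _ "sqrt ww * (2 * r * R / (R + r * (\<sigma> + s))\<^sup>2) - h' s"] conjI
        DERIV_diff td hd s) linarith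
  qed
  moreover have "sqrt ww * turn R r (\<sigma> + 0) + h 0 \<le> sqrt ww * turn R r (\<sigma> + L) + h L"
  proof (rule DERIV_nonneg_imp_nondecreasing[OF L])
    fix s assume s: "0 \<le> s" "s \<le> L"
    show "\<exists>y. ((\<lambda>s. sqrt ww * turn R r (\<sigma> + s) + h s) has_real_derivative y) (at s) \<and> 0 \<le> y"
      using hb[OF s] by (intro exI[of _ "sqrt ww * (2 * r * R / (R + r * (\<sigma> + s))\<^sup>2) + h' s"] conjI
        DERIV_add td hd s) linarith
  qed
  ultimately show ?thesis by (simp add: ww_def right_diff_distrib abs_le_iff)
qed

section \<open>Paths that are linear between finitely many times\<close>

text \<open>Cutting at an interior point of \<open>C\<close> leaves fewer such points on both sides.
  This carries conservation laws and estimates across collisions: only free flight and composition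
  have to be checked.\<close>

lemma interval_induct:
  fixes C :: "real set"
  assumes C: "finite C"
    and step: "\<And>a b. lo \<le> a \<Longrightarrow> a < b \<Longrightarrow> b \<le> hi \<Longrightarrow> C \<inter> {a<..<b} = {} \<Longrightarrow> P a b"
    and trans: "\<And>a b c. lo \<le> a \<Longrightarrow> a < b \<Longrightarrow> b < c \<Longrightarrow> c \<le> hi \<Longrightarrow> P a b \<Longrightarrow> P b c \<Longrightarrow> P a c"
    and "lo \<le> a" "a < b" "b \<le> hi"
  shows "P a b"
  using assms(4-6)
proof (induction "card (C \<inter> {a<..<b})" arbitrary: a b rule: less_induct)
  case less
  show ?case
  proof (cases "C \<inter> {a<..<b} = {}")
    case True
    then show ?thesis using step less.prems by blast
  next
    case False
    then obtain c where c: "c \<in> C" "a < c" "c < b" by auto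
    have "card (C \<inter> {a<..<c}) < card (C \<inter> {a<..<b})" "card (C \<inter> {c<..<b}) < card (C \<inter> {a<..<b})"
      using c C by (auto intro!: psubset_card_mono)
    then have "P a c" "P c b" using less.hyps less.prems c by auto
    then show ?thesis using trans[of a c b] less.prems c by simp
  qed
qed

text \<open>On a linear piece \<open>V a\<close> is also the velocity just before \<open>b\<close>,
  so \<open>jump\<close> says that a change of velocity never lowers the radial product. With
  \<open>p\<close> the radial product and \<open>q\<close> the squared norm, \<open>p\<close> grows
  at rate at least \<open>r\<^sup>2\<close>, and integrating gives the growth of \<open>q\<close>.
  The Gram determinant \<open>r\<^sup>2 * q - p\<^sup>2\<close> is constant on linear pieces and can
  only drop at jumps. These facts feed \<open>line_turning\<close> on each piece.\<close>

lemma
  fixes Z V :: "real \<Rightarrow> 'i \<Rightarrow> real"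
  assumes C: "finite C" and R: "0 < R" and r: "0 < r"
    and lin: "\<And>a b s i. t0 \<le> a \<Longrightarrow> a < b \<Longrightarrow> b \<le> T \<Longrightarrow> C \<inter> {a<..<b} = {} \<Longrightarrow>
        s \<in> {a..b} \<Longrightarrow> i \<in> I \<Longrightarrow> Z s i = Z a i + (s - a) * V a i"
    and jump: "\<And>a b. t0 \<le> a \<Longrightarrow> a < b \<Longrightarrow> b \<le> T \<Longrightarrow> C \<inter> {a<..<b} = {} \<Longrightarrow>
        ip I (Z b) (V a) \<le> ip I (Z b) (V b)"
    and en: "\<And>t. t0 \<le> t \<Longrightarrow> t \<le> T \<Longrightarrow> ip I (V t) (V t) = r\<^sup>2"
    and Z0: "ip I (Z t0) (Z t0) = R\<^sup>2" and p0: "0 \<le> ip I (Z t0) (V t0)"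
  shows broken_line_growth: "\<And>t. t0 \<le> t \<Longrightarrow> t \<le> T \<Longrightarrow> R\<^sup>2 + (r * (t - t0))\<^sup>2 \<le> ip I (Z t) (Z t)"
    and broken_line_turning: "\<And>s t w. t0 \<le> s \<Longrightarrow> s \<le> t \<Longrightarrow> t \<le> T \<Longrightarrow>
      \<bar>ip I w (Z t) / sqrt (ip I (Z t) (Z t)) - ip I w (Z s) / sqrt (ip I (Z s) (Z s))\<bar>
      \<le> sqrt (ip I w w) * (turn R r (t - t0) - turn R r (s - t0))"
proof -
  define p where "p t = ip I (Z t) (V t)" for t
  define q where "q t = ip I (Z t) (Z t)" for t
  have pl: "ip I (Z b) (V a) = p a + (b - a) * r\<^sup>2"
    if "t0 \<le> a" "a < b" "b \<le> T" "C \<inter> {a<..<b} = {}" for a b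
  proof -
    have "ip I (Z b) (V a) = ip I (\<lambda>i. Z a i + (b - a) * V a i) (V a)"
      using lin[OF that, of b] that by (intro ip_cong) auto
    also have "\<dots> = ip I (V a) (\<lambda>i. Z a i + (b - a) * V a i)" by (rule ip_commute)
    also have "\<dots> = ip I (V a) (Z a) + (b - a) * ip I (V a) (V a)"
      by (rule ip_add_scaled_right)
    also have "ip I (V a) (Z a) = p a" unfolding p_def by (rule ip_commute)
    finally show ?thesis using en[of a] that by simp
  qed
  have ql: "ip I (\<lambda>i. Z a i + (b - a) * V a i) (\<lambda>i. Z a i + (b - a) * V a i) = q b"
    if "t0 \<le> a" "a < b" "b \<le> T" "C \<inter> {a<..<b} = {}" for a b
    unfolding q_def using lin[OF that, of b] that by (intro ip_cong) auto
  have qe: "q b = q a + 2 * (b - a) * p a + (b - a)\<^sup>2 * r\<^sup>2"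
    if "t0 \<le> a" "a < b" "b \<le> T" "C \<inter> {a<..<b} = {}" for a b
    using ql[OF that] en[of a] that by (simp add: ip_line p_def q_def)
  have p: "p b \<ge> p a + (b - a) * r\<^sup>2" if "t0 \<le> a" "a < b" "b \<le> T" for a b
  proof (rule interval_induct[where P = "\<lambda>a b. p b \<ge> p a + (b - a) * r\<^sup>2", OF C _ _ that])
    fix a b assume h: "t0 \<le> a" "a < b" "b \<le> T" "C \<inter> {a<..<b} = {}"
    show "p a + (b - a) * r\<^sup>2 \<le> p b" using jump[OF h] pl[OF h] by (simp add: p_def)
  qed (auto simp: algebra_simps)
  have plow: "p t \<ge> (t - t0) * r\<^sup>2" if "t0 \<le> t" "t \<le> T" for t
  proof (cases "t = t0")
    case False
    then show ?thesis using p[of t0 t] that p0 by (simp add: p_def)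
  qed (use p0 in \<open>simp add: p_def\<close>)
  \<comment> \<open>The sign matters for \<open>D1\<close>: raising \<open>p\<close> raises its
    square because \<open>p\<close> is not negative.\<close>
  have p0': "p t \<ge> 0" if "t0 \<le> t" "t \<le> T" for t
  proof -
    have "0 \<le> (t - t0) * r\<^sup>2" using that by simp
    then show ?thesis using plow[OF that] by linarith
  qed
  have q: "q b - (r * (b - t0))\<^sup>2 \<ge> q a - (r * (a - t0))\<^sup>2" if "t0 \<le> a" "a < b" "b \<le> T" for a b
  proof (rule interval_induct[where P = "\<lambda>a b. q b - (r * (b - t0))\<^sup>2 \<ge> q a - (r * (a - t0))\<^sup>2", OF C _ _ that])
    fix a b assume h: "t0 \<le> a" "a < b" "b \<le> T" "C \<inter> {a<..<b} = {}"
    have "(b - a) * ((a - t0) * r\<^sup>2) \<le> (b - a) * p a" using plow[of a] h by (simp add: mult_left_mono)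
    then show "q b - (r * (b - t0))\<^sup>2 \<ge> q a - (r * (a - t0))\<^sup>2"
      unfolding qe[OF h] by (simp add: algebra_simps power2_eq_square)
  qed (auto simp: algebra_simps)
  have growth: "R\<^sup>2 + (r * (t - t0))\<^sup>2 \<le> q t" if "t0 \<le> t" "t \<le> T" for t
  proof (cases "t = t0")
    case False
    then show ?thesis using q[of t0 t] that Z0 by (simp add: q_def)
  qed (use Z0 in \<open>simp add: q_def\<close>)
  then show "R\<^sup>2 + (r * (t - t0))\<^sup>2 \<le> ip I (Z t) (Z t)" if "t0 \<le> t" "t \<le> T" for t
    using that by (simp add: q_def)
  have D1: "r\<^sup>2 * q b - (p b)\<^sup>2 \<le> r\<^sup>2 * q a - (p a)\<^sup>2" if "t0 \<le> a" "a < b" "b \<le> T" for a b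
  proof (rule interval_induct[where P = "\<lambda>a b. r\<^sup>2 * q b - (p b)\<^sup>2 \<le> r\<^sup>2 * q a - (p a)\<^sup>2", OF C _ _ that])
    fix a b assume h: "t0 \<le> a" "a < b" "b \<le> T" "C \<inter> {a<..<b} = {}"
    have "0 \<le> p a + (b - a) * r\<^sup>2" using p0'[of a] h by simp
    then have "(p a + (b - a) * r\<^sup>2)\<^sup>2 \<le> (p b)\<^sup>2"
      using jump[OF h] pl[OF h] by (intro power_mono) (simp_all add: p_def)
    then show "r\<^sup>2 * q b - (p b)\<^sup>2 \<le> r\<^sup>2 * q a - (p a)\<^sup>2"
      unfolding qe[OF h] by (simp add: algebra_simps power2_eq_square)
  qed (auto simp: algebra_simps)
  have D: "r\<^sup>2 * q t - (p t)\<^sup>2 \<le> (r * R)\<^sup>2" if "t0 \<le> t" "t \<le> T" for t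
  proof -
    have "r\<^sup>2 * q t0 - (p t0)\<^sup>2 \<le> (r * R)\<^sup>2" using Z0 by (simp add: q_def power_mult_distrib)
    then show ?thesis using D1[of t0 t] that by (cases "t = t0") auto
  qed
  define h where "h w t = ip I w (Z t) / sqrt (q t)" for w t
  have main: "\<bar>h w t - h w s\<bar> \<le> sqrt (ip I w w) * (turn R r (t - t0) - turn R r (s - t0))"
    if "t0 \<le> s" "s < t" "t \<le> T" for s t w
  proof (rule interval_induct[where P = "\<lambda>s t. \<bar>h w t - h w s\<bar> \<le> sqrt (ip I w w) * (turn R r (t - t0) - turn R r (s - t0))", OF C _ _ that])
    fix a b assume ab: "t0 \<le> a" "a < b" "b \<le> T" "C \<inter> {a<..<b} = {}"
    have sub: "ip I (\<lambda>i. Z a i + s * V a i) (\<lambda>i. Z a i + s * V a i) = q (a + s)"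
      "ip I w (\<lambda>i. Z a i + s * V a i) = ip I w (Z (a + s))"
      if s: "0 \<le> s" "s \<le> b - a" for s
      unfolding q_def using lin[OF ab, of "a + s"] s by (auto intro!: ip_cong)
    have "\<bar>ip I w (\<lambda>i. Z a i + (b - a) * V a i) / sqrt (ip I (\<lambda>i. Z a i + (b - a) * V a i) (\<lambda>i. Z a i + (b - a) * V a i))
       - ip I w (\<lambda>i. Z a i + 0 * V a i) / sqrt (ip I (\<lambda>i. Z a i + 0 * V a i) (\<lambda>i. Z a i + 0 * V a i))\<bar>
      \<le> sqrt (ip I w w) * (turn R r ((a - t0) + (b - a)) - turn R r (a - t0))"
    proof (rule line_turning[OF _ _ R r])
      show "r\<^sup>2 * ip I (Z a) (Z a) - (ip I (Z a) (V a))\<^sup>2 \<le> (r * R)\<^sup>2"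
        using D[of a] ab by (simp add: q_def p_def)
      fix s assume s: "0 \<le> s" "s \<le> b - a"
      show "R\<^sup>2 + (r * (a - t0 + s))\<^sup>2 \<le> ip I (\<lambda>i. Z a i + s * V a i) (\<lambda>i. Z a i + s * V a i)"
        unfolding sub[OF s] using growth[of "a + s"] s ab by (simp add: algebra_simps)
    qed (use ab en in auto)
    then show "\<bar>h w b - h w a\<bar> \<le> sqrt (ip I w w) * (turn R r (b - t0) - turn R r (a - t0))"
      using sub[of "b - a"] ab by (simp add: h_def q_def)
  next
    fix a b c :: real
    assume "\<bar>h w b - h w a\<bar> \<le> sqrt (ip I w w) * (turn R r (b - t0) - turn R r (a - t0))"
      "\<bar>h w c - h w b\<bar> \<le> sqrt (ip I w w) * (turn R r (c - t0) - turn R r (b - t0))"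
    then show "\<bar>h w c - h w a\<bar> \<le> sqrt (ip I w w) * (turn R r (c - t0) - turn R r (a - t0))"
      by (simp only: right_diff_distrib abs_le_iff) linarith
  qed
  show "\<bar>ip I w (Z t) / sqrt (ip I (Z t) (Z t)) - ip I w (Z s) / sqrt (ip I (Z s) (Z s))\<bar>
      \<le> sqrt (ip I w w) * (turn R r (t - t0) - turn R r (s - t0))" if "t0 \<le> s" "s \<le> t" "t \<le> T" for s t w
    using main[of s t w] that by (cases "s = t") (auto simp: h_def q_def)
qed

section \<open>The collisions of a single pair\<close>

lemma linear_right_derivative:
  fixes f :: "real \<Rightarrow> real"
  assumes "a < b" and lin: "\<And>s. s \<in> {a..b} \<Longrightarrow> f s = f a + (s - a) * u"
  shows "vector_derivative f (at_right a) = u"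
proof -
  have "((\<lambda>s. f a + (s - a) * u) has_vector_derivative u) (at a within {a..})"
    by (auto intro!: derivative_eq_intros simp: has_real_derivative_iff_has_vector_derivative[symmetric])
  then have "(f has_vector_derivative u) (at a within {a..})"
  proof (rule has_vector_derivative_transform_within[where d = "b - a"])
    fix s assume "s \<in> {a..}" "dist s a < b - a"
    then show "f a + (s - a) * u = f s" using lin[of s] by (auto simp: dist_real_def)
  qed (use assms(1) in auto)
  then have "(f has_vector_derivative u) (at_right a)"
    by (rule has_vector_derivative_within_subset) auto
  then show ?thesis by (rule vector_derivative_within[rotated]) simp
qed

lemma linear_left_derivative:
  fixes f :: "real \<Rightarrow> real"
  assumes "a < b" and lin: "\<And>s. s \<in> {a..b} \<Longrightarrow> f s = f a + (s - a) * u"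
  shows "vector_derivative f (at_left b) = u"
proof -
  have "((\<lambda>s. f a + (s - a) * u) has_vector_derivative u) (at b within {..b})"
    by (auto intro!: derivative_eq_intros simp: has_real_derivative_iff_has_vector_derivative[symmetric])
  then have "(f has_vector_derivative u) (at b within {..b})"
  proof (rule has_vector_derivative_transform_within[where d = "b - a"])
    fix s assume "s \<in> {..b}" "dist s b < b - a"
    then show "f a + (s - a) * u = f s" using lin[of s] by (auto simp: dist_real_def)
  qed (use assms(1) in auto)
  then have "(f has_vector_derivative u) (at_left b)"
    by (rule has_vector_derivative_within_subset) auto
  then show ?thesis by (rule vector_derivative_within[rotated]) simp
qed

lemma centre_dist_commute: "centre_dist d x j k t = centre_dist d x k j t"
  by (simp add: centre_dist_def L2_set_def power2_commute)

lemma collide_commute: "collide d x j k t \<longleftrightarrow> collide d x k j t"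
  by (auto simp: collide_def in_contact_def centre_dist_commute)

lemma collide_imp_neq: "collide d x j k t \<Longrightarrow> j \<noteq> k"
  by (auto simp: collide_def in_contact_def centre_dist_def L2_set_def)

lemma centre_dist_sq: "(centre_dist d x j k t)\<^sup>2 = (\<Sum>i<d. (x j t i - x k t i)\<^sup>2)"
  by (simp add: centre_dist_def L2_set_def sum_nonneg)

lemma sum_change_two:
  fixes f g :: "'a \<Rightarrow> real"
  assumes "finite S" "j \<in> S" "k \<in> S" "j \<noteq> k" "\<And>l. l \<in> S \<Longrightarrow> l \<noteq> j \<Longrightarrow> l \<noteq> k \<Longrightarrow> f l = g l"
  shows "sum f S = sum g S + (f j - g j) + (f k - g k)"
proof -
  have "sum f (S - {j} - {k}) = sum g (S - {j} - {k})" using assms(5) by (intro sum.cong) auto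
  moreover have "sum h S = h j + (h k + sum h (S - {j} - {k}))" for h :: "'a \<Rightarrow> real"
    using assms(1-4) by (simp add: sum.remove[of S j] sum.remove[of "S - {j}" k])
  ultimately show ?thesis by simp
qed

section \<open>Coordinates relative to the centre of mass\<close>

definition centred :: "nat set \<Rightarrow> (nat \<Rightarrow> nat \<Rightarrow> real) \<Rightarrow> nat \<times> nat \<Rightarrow> real" where
  "centred S f = (\<lambda>(k, i). f k i - (\<Sum>l\<in>S. f l i) / real (card S))"

text \<open>The covariance identity: subtracting the means costs the product of the sums divided by
  the number of balls. A collision can thus be tested on plain sums over balls once total momentum
  is known to be unchanged.\<close>

lemma ip_centred:
  assumes S: "finite S" "S \<noteq> {}"
  shows "ip (S \<times> {..<d}) (centred S f) (centred S g) =
    (\<Sum>k\<in>S. dot d (f k) (g k)) - (\<Sum>i<d. (\<Sum>l\<in>S. f l i) * (\<Sum>l\<in>S. g l i)) / real (card S)"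
proof -
  define m where "m = real (card S)"
  have m: "m > 0" using S by (simp add: m_def card_gt_0_iff)
  have one: "(\<Sum>k\<in>S. (f k i - (\<Sum>l\<in>S. f l i) / m) * (g k i - (\<Sum>l\<in>S. g l i) / m))
     = (\<Sum>k\<in>S. f k i * g k i) - (\<Sum>l\<in>S. f l i) * (\<Sum>l\<in>S. g l i) / m" for i
  proof -
    define F G where "F = (\<Sum>l\<in>S. f l i)" and "G = (\<Sum>l\<in>S. g l i)"
    have "(\<Sum>k\<in>S. (f k i - F / m) * (g k i - G / m))
       = (\<Sum>k\<in>S. f k i * g k i - G / m * f k i - F / m * g k i + F / m * (G / m))"
      by (intro sum.cong) (simp_all add: algebra_simps)
    also have "\<dots> = (\<Sum>k\<in>S. f k i * g k i) - G / m * F - F / m * G + F / m * (m * (G / m))"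
      by (simp only: sum.distrib sum_subtractf sum_distrib_left[symmetric] F_def[symmetric] G_def[symmetric]
          sum_constant m_def[symmetric])
    also have "\<dots> = (\<Sum>k\<in>S. f k i * g k i) - F * G / m" using m by simp
    finally show ?thesis by (simp add: F_def G_def)
  qed
  have "ip (S \<times> {..<d}) (centred S f) (centred S g) =
    (\<Sum>k\<in>S. \<Sum>i<d. (f k i - (\<Sum>l\<in>S. f l i) / m) * (g k i - (\<Sum>l\<in>S. g l i) / m))"
    unfolding ip_def sum.cartesian_product by (intro sum.cong) (auto simp: centred_def m_def)
  also have "\<dots> = (\<Sum>i<d. (\<Sum>k\<in>S. f k i * g k i) - (\<Sum>l\<in>S. f l i) * (\<Sum>l\<in>S. g l i) / m)"
    unfolding one[symmetric] by (rule sum.swap)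
  also have "\<dots> = (\<Sum>k\<in>S. dot d (f k) (g k)) - (\<Sum>i<d. (\<Sum>l\<in>S. f l i) * (\<Sum>l\<in>S. g l i)) / m"
    unfolding sum_subtractf sum_divide_distrib dot_def by (subst sum.swap) simp
  finally show ?thesis by (simp add: m_def)
qed

section \<open>Evolutions in which collisions are separated by a fixed distance\<close>

text \<open>\<open>\<delta>\<close> stays a parameter and becomes \<open>n\<close> to the power
  \<open>- n\<close> only in the main theorem. The colliding pair in \<open>sep\<close> is not
  sorted, so that the proofs can take it in either order.\<close>

locale separated_evolution =
  fixes n d :: nat and x :: motion and \<delta> :: real
  assumes evol: "hard_ball_evolution n d x"
    and delta_pos: "0 < \<delta>"
    and sep: "\<And>j k t l m. collide d x j k t \<Longrightarrow> j < n \<Longrightarrow> k < n \<Longrightarrow> l < n \<Longrightarrow> m < n \<Longrightarrow> l \<noteq> m \<Longrightarrow>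
      {l, m} \<noteq> {j, k} \<Longrightarrow> \<delta> < ball_dist d x l m t"
begin

lemma continuous_coordinate: "k < n \<Longrightarrow> i < d \<Longrightarrow> continuous_on A (\<lambda>t. x k t i)"
  using evol by (auto simp: hard_ball_evolution_def intro: continuous_on_subset)

lemma continuous_centre_dist: "j < n \<Longrightarrow> k < n \<Longrightarrow> continuous_on A (centre_dist d x j k)"
  unfolding centre_dist_def L2_set_def
  by (intro continuous_intros continuous_coordinate) auto

lemma elastic: "collide d x j k t \<Longrightarrow> j < n \<Longrightarrow> k < n \<Longrightarrow> elastic_law d x j k t"
  using evol by (simp add: hard_ball_evolution_def)

text \<open>The evolution provides a constant derivative only inside the open interval. Subtracting
  the linear function and using continuity extends the formula to both endpoints, where the
  one-sided derivatives can be read off.\<close>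

lemma
  assumes k: "k < n" and ab: "a < b"
    and free: "\<And>t j. a < t \<Longrightarrow> t < b \<Longrightarrow> j < n \<Longrightarrow> \<not> collide d x j k t"
    and i: "i < d"
  shows free_flight_position:
      "\<And>s. s \<in> {a..b} \<Longrightarrow> x k s i = x k a i + (s - a) * vel_after x k a i"
    and free_flight_velocity: "vel_before x k b i = vel_after x k a i"
proof -
  have "\<exists>u. \<forall>t\<in>{a<..<b}. \<forall>i<d. ((\<lambda>s. x k s i) has_real_derivative u i) (at t)"
    using evol k ab free unfolding hard_ball_evolution_def by simp
  then obtain u where u: "\<And>t. t \<in> {a<..<b} \<Longrightarrow> ((\<lambda>s. x k s i) has_real_derivative u) (at t)"
    using i by blast
  have lin: "x k s i = x k a i + (s - a) * u" if s: "s \<in> {a..b}" for s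
  proof -
    have "(\<lambda>s. x k s i - (s - a) * u) s = (\<lambda>s. x k s i - (s - a) * u) a"
    proof (rule DERIV_isconst2[OF ab])
      show "continuous_on {a..b} (\<lambda>s. x k s i - (s - a) * u)"
        by (intro continuous_intros continuous_coordinate k i)
      show "((\<lambda>s. x k s i - (s - a) * u) has_real_derivative 0) (at t)" if "a < t" "t < b" for t
        using u[of t] that by (auto intro!: derivative_eq_intros)
    qed (use s in auto)
    then show ?thesis by simp
  qed
  have after: "vel_after x k a i = u" unfolding vel_after_def
    by (rule linear_right_derivative[OF ab]) (rule lin)
  show "x k s i = x k a i + (s - a) * vel_after x k a i" if "s \<in> {a..b}" for s
    unfolding after using that by (rule lin)
  show "vel_before x k b i = vel_after x k a i" unfolding vel_before_def after
    by (rule linear_left_derivative[OF ab]) (rule lin)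
qed

text \<open>The outward relative velocity after a collision makes the squared distance of the pair, as long
  as it flies freely, a convex function that is increasing from the start.\<close>

lemma recollision_needs_third_ball:
  assumes c: "collide d x j k s" "collide d x j k s'" and ss: "s < s'" and jk: "j < n" "k < n"
  shows "\<exists>u p q. s < u \<and> u < s' \<and> p < n \<and> q < n \<and> collide d x p q u \<and> {p, q} \<noteq> {j, k}"
proof (rule ccontr)
  assume "\<not> ?thesis"
  then have only: "{p, q} = {j, k}" if "s < u" "u < s'" "p < n" "q < n" "collide d x p q u" for u p q
    using that by blast
  have nj: "j \<noteq> k" using collide_imp_neq[OF c(1)] .
  have no_third: "collide d x j k u"
    if "s < u" "u < s'" "p < n" "q = j \<or> q = k" "collide d x p q u" for u p q
  proof -
    have "{p, q} = {j, k}" using only[of u p q] that jk by auto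
    then have "p = j \<and> q = k \<or> p = k \<and> q = j" by (auto simp: doubleton_eq_iff)
    then show ?thesis using that(5) collide_commute by blast
  qed
  \<comment> \<open>Collision times might still accumulate here, so a first recollision need not
    exist. The infimum replaces it: contact is a closed condition and therefore holds at
    \<open>t\<close>.\<close>
  define T where "T = {u. s < u \<and> u \<le> s' \<and> collide d x j k u}"
  define t where "t = Inf T"
  have T: "s' \<in> T" "bdd_below T" using c ss by (auto simp: T_def bdd_below_def intro!: exI[of _ s])
  have st: "s \<le> t" unfolding t_def by (rule cInf_greatest) (use T in \<open>auto simp: T_def\<close>)
  have tT: "t \<le> u" if "u \<in> T" for u unfolding t_def by (rule cInf_lower[OF that T(2)])
  have contact: "centre_dist d x j k u = 2" if "u \<in> T" for u
    using that by (simp add: T_def collide_def in_contact_def)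
  have "closed {u. centre_dist d x j k u = 2}"
    using continuous_closed_vimage[OF closed_singleton[of "2::real"], of "centre_dist d x j k"]
      continuous_centre_dist[OF jk, of UNIV]
    by (simp add: vimage_def continuous_on_eq_continuous_at[OF open_UNIV])
  then have "closure T \<subseteq> {u. centre_dist d x j k u = 2}"
    using contact by (intro closure_minimal) auto
  moreover have "t \<in> closure T" unfolding t_def by (rule closure_contains_Inf) (use T in auto)
  ultimately have ct: "centre_dist d x j k t = 2" by auto
  define v where "v i = vel_after x j s i - vel_after x k s i" for i
  define y where "y u i = x j u i - x k u i" for u i
  have cs: "centre_dist d x j k s = 2" using c(1) by (simp add: collide_def in_contact_def)
  \<comment> \<open>The elastic law reverses the normal component of the relative velocity: the sum
    equals \<open>- dot d p (y s)\<close>, and the balls were approaching.\<close>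
  have out: "0 < (\<Sum>i<d. y s i * v i)"
  proof -
    define e where "e i = y s i / 2" for i
    define p where "p i = vel_before x j s i - vel_before x k s i" for i
    have el: "dot d p (y s) < 0"
      "\<And>i. i < d \<Longrightarrow> vel_after x j s i = vel_before x j s i + dot d (vel_before x k s) e * e i - dot d (vel_before x j s) e * e i"
      "\<And>i. i < d \<Longrightarrow> vel_after x k s i = vel_before x k s i + dot d (vel_before x j s) e * e i - dot d (vel_before x k s) e * e i"
      using elastic[OF c(1) jk] cs by (auto simp: elastic_law_def Let_def e_def[abs_def] y_def[abs_def] p_def[abs_def])
    define g where "g = dot d (vel_before x k s) e - dot d (vel_before x j s) e"
    have "v i = p i + 2 * g * e i" if "i < d" for i
      using el(2,3)[OF that] by (simp add: v_def p_def g_def algebra_simps)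
    then have "(\<Sum>i<d. y s i * v i) = (\<Sum>i<d. y s i * p i + g * (y s i)\<^sup>2)"
      by (intro sum.cong) (auto simp: e_def algebra_simps power2_eq_square)
    also have "\<dots> = dot d p (y s) + g * 4"
      using centre_dist_sq[of d x j k s] cs
      by (simp add: sum.distrib sum_distrib_left[symmetric] dot_def y_def mult.commute)
    also have "g = - dot d p (y s) / 2"
      by (simp add: g_def dot_def e_def p_def sum_subtractf[symmetric] sum_divide_distrib
          sum_negf[symmetric] algebra_simps diff_divide_distrib)
    finally show ?thesis using el(1) by simp
  qed
  have yl: "y u i = y s i + (u - s) * v i"
    if "s < w" "u \<in> {s..w}" "i < d" "\<And>u'. s < u' \<Longrightarrow> u' < w \<Longrightarrow> \<not> collide d x j k u'" "w \<le> s'" for u w i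
  proof -
    have nc: "\<not> collide d x p q u'" if "s < u'" "u' < w" "p < n" "q = j \<or> q = k" for u' p q
      using no_third[of u' p q] that \<open>\<And>u'. s < u' \<Longrightarrow> u' < w \<Longrightarrow> \<not> collide d x j k u'\<close> \<open>w \<le> s'\<close> by fastforce
    have "x j u i = x j s i + (u - s) * vel_after x j s i"
      by (rule free_flight_position[OF jk(1) that(1) _ that(3,2)]) (use nc in blast)
    moreover have "x k u i = x k s i + (u - s) * vel_after x k s i"
      by (rule free_flight_position[OF jk(2) that(1) _ that(3,2)]) (use nc in blast)
    ultimately show ?thesis by (simp add: y_def v_def algebra_simps)
  qed
  \<comment> \<open>In free flight the squared distance is 4 plus a positive linear term plus a
    nonnegative quadratic term.\<close>
  have far: "centre_dist d x j k w \<noteq> 2"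
    if "s < w" "w \<le> s'" "\<And>u'. s < u' \<Longrightarrow> u' < w \<Longrightarrow> \<not> collide d x j k u'" for w
  proof
    assume "centre_dist d x j k w = 2"
    then have "(\<Sum>i<d. (y w i)\<^sup>2) = 4" using centre_dist_sq[of d x j k w] by (simp add: y_def)
    moreover have "(\<Sum>i<d. (y w i)\<^sup>2) = (\<Sum>i<d. (y s i)\<^sup>2 + (w - s) * 2 * (y s i * v i) + (w - s)\<^sup>2 * (v i)\<^sup>2)"
    proof (rule sum.cong)
      fix i assume "i \<in> {..<d}"
      then have "y w i = y s i + (w - s) * v i" using yl[of w w i] that by auto
      then show "(y w i)\<^sup>2 = (y s i)\<^sup>2 + (w - s) * 2 * (y s i * v i) + (w - s)\<^sup>2 * (v i)\<^sup>2"
        by (simp only: power2_eq_square) (simp add: algebra_simps)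
    qed simp
    moreover have "\<dots> = 4 + (w - s) * 2 * (\<Sum>i<d. y s i * v i) + (w - s)\<^sup>2 * (\<Sum>i<d. (v i)\<^sup>2)"
      using centre_dist_sq[of d x j k s] cs
      by (simp add: sum.distrib sum_distrib_left[symmetric] y_def)
    moreover have "0 < (w - s) * 2 * (\<Sum>i<d. y s i * v i)" using out that by simp
    moreover have "0 \<le> (w - s)\<^sup>2 * (\<Sum>i<d. (v i)\<^sup>2)" by (simp add: sum_nonneg)
    ultimately show False by linarith
  qed
  show False
  proof (cases "s < t")
    case True
    have "\<not> collide d x j k u" if "s < u" "u < t" for u
      using tT[of u] that tT[OF T(1)] by (auto simp: T_def)
    then show False using far[OF True] ct tT[OF T(1)] by blast
  next
    case False
    then have ts: "t = s" using st by simp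
    text \<open>Contacts accumulating at \<open>s\<close> from the right contradict the right derivative of the squared
      distance, which exists although the free flight after \<open>s\<close> has not been established yet.\<close>
    define F where "F u = (\<Sum>i<d. (y u i)\<^sup>2)" for u
    have der: "((\<lambda>u. x l u i) has_vector_derivative vel_after x l s i) (at_right s)" if "l < n" "i < d" for l i
      using evol that unfolding hard_ball_evolution_def vel_after_def
      by (auto simp: vector_derivative_works[symmetric])
    have dy: "((\<lambda>u. y u i) has_real_derivative v i) (at_right s)" if "i < d" for i
      unfolding y_def v_def has_real_derivative_iff_has_vector_derivative
      by (intro has_vector_derivative_diff der that jk)
    have "(F has_real_derivative (\<Sum>i<d. 2 * (y s i * v i))) (at_right s)"
      unfolding F_def by (rule DERIV_sum) (auto intro!: derivative_eq_intros dy simp: algebra_simps)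
    moreover have "0 < (\<Sum>i<d. 2 * (y s i * v i))" using out by (simp add: sum_distrib_left[symmetric])
    ultimately obtain \<eta> where eta: "\<eta> > 0" "\<And>h. h > 0 \<Longrightarrow> s + h \<in> {s<..} \<Longrightarrow> h < \<eta> \<Longrightarrow> F s < F (s + h)"
      using has_real_derivative_pos_inc_right[of F _ s "{s<..}"] by blast
    have "\<exists>u\<in>T. u < s + \<eta>" using cInf_lessD[of T "s + \<eta>"] T eta(1) ts unfolding t_def by auto
    then obtain u where u: "u \<in> T" "u < s + \<eta>" by blast
    have "F s < F u" using eta(2)[of "u - s"] u by (auto simp: T_def)
    moreover have "F s = 4" "F u = 4"
      using centre_dist_sq[of d x j k s] centre_dist_sq[of d x j k u] contact[OF u(1)] cs
      by (simp_all add: F_def y_def)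
    ultimately show False by simp
  qed
qed

text \<open>Near \<open>T\<close> every pair distance varies by less than \<open>\<delta>\<close>,
  while a collision of a different pair would need that pair to come from beyond
  \<open>\<delta>\<close> to contact. So all nearby collisions belong to one pair, and
  \<open>recollision_needs_third_ball\<close> forbids it to collide twice there.\<close>

lemma locally_single_collision:
  "\<exists>\<epsilon>>0. \<forall>s s' j k p q. \<bar>s - T\<bar> < \<epsilon> \<longrightarrow> \<bar>s' - T\<bar> < \<epsilon> \<longrightarrow> j < n \<longrightarrow> k < n \<longrightarrow> p < n \<longrightarrow> q < n \<longrightarrow>
     collide d x j k s \<longrightarrow> collide d x p q s' \<longrightarrow> s = s'"
proof -
  have "\<exists>\<epsilon>>0. \<forall>s. \<bar>s - T\<bar> < \<epsilon> \<longrightarrow> \<bar>centre_dist d x l m s - centre_dist d x l m T\<bar> < \<delta> / 2"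
    if "l < n" "m < n" for l m
  proof -
    have "\<forall>r>0. \<exists>\<epsilon>>0. \<forall>s. \<bar>s - T\<bar> < \<epsilon> \<longrightarrow> \<bar>centre_dist d x l m s - centre_dist d x l m T\<bar> < r"
      using continuous_centre_dist[OF that, of UNIV] by (simp add: continuous_on_iff dist_real_def)
    then show ?thesis using delta_pos half_gt_zero by blast
  qed
  then obtain e where e: "\<And>l m. l < n \<Longrightarrow> m < n \<Longrightarrow> e l m > 0 \<and>
      (\<forall>s. \<bar>s - T\<bar> < e l m \<longrightarrow> \<bar>centre_dist d x l m s - centre_dist d x l m T\<bar> < \<delta> / 2)"
    by metis
  define \<epsilon> where "\<epsilon> = Min (insert 1 ((\<lambda>(l, m). e l m) ` ({..<n} \<times> {..<n})))"
  have eps: "0 < \<epsilon>" unfolding \<epsilon>_def using e by (subst Min_gr_iff) auto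
  have le: "\<epsilon> \<le> e l m" if "l < n" "m < n" for l m
    unfolding \<epsilon>_def using that by (intro Min_le) auto
  have same: "{j, k} = {p, q}"
    if "\<bar>s - T\<bar> < \<epsilon>" "\<bar>s' - T\<bar> < \<epsilon>" "j < n" "k < n" "p < n" "q < n" "collide d x j k s" "collide d x p q s'"
    for s s' j k p q
  proof (rule ccontr)
    assume "{j, k} \<noteq> {p, q}"
    then have "\<delta> < ball_dist d x p q s" using sep[of j k s p q] that collide_imp_neq[OF that(8)] by auto
    moreover have "centre_dist d x p q s' = 2" using that(8) by (simp add: collide_def in_contact_def)
    moreover have "\<bar>centre_dist d x p q s - centre_dist d x p q T\<bar> < \<delta> / 2"
      "\<bar>centre_dist d x p q s' - centre_dist d x p q T\<bar> < \<delta> / 2"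
      using e[OF that(5,6)] le[OF that(5,6)] that(1,2) by auto
    ultimately show False unfolding ball_dist_def by linarith
  qed
  have not_less: False
    if "\<bar>s - T\<bar> < \<epsilon>" "\<bar>s' - T\<bar> < \<epsilon>" "j < n" "k < n" "p < n" "q < n" "collide d x j k s" "collide d x p q s'" "s < s'"
    for s s' j k p q
  proof -
    have "{j, k} = {p, q}" using same that by blast
    then have "j = p \<and> k = q \<or> j = q \<and> k = p" by (auto simp: doubleton_eq_iff)
    then have "collide d x j k s'" using that(8) collide_commute by blast
    from recollision_needs_third_ball[OF that(7) this that(9,3,4)]
    obtain u p' q' where u: "s < u" "u < s'" "p' < n" "q' < n" "collide d x p' q' u" "{p', q'} \<noteq> {j, k}" by blast
    have "\<bar>u - T\<bar> < \<epsilon>" using u that(1,2) by linarith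
    then show False using same[of u s p' q' j k] u that by auto
  qed
  show ?thesis
    by (rule exI[of _ \<epsilon>]) (use eps not_less in \<open>metis linorder_neqE_linordered_idom\<close>)
qed

section \<open>Finiteness of the set of collision times in a bounded interval\<close>

definition collision_times :: "real \<Rightarrow> real \<Rightarrow> real set" where
  "collision_times a b = {t \<in> {a..b}. \<exists>j<n. \<exists>k<n. collide d x j k t}"

text \<open>Infinitely many times would have a limit point, around which
  \<open>locally_single_collision\<close> leaves at most one collision time.\<close>

lemma finite_collision_times: "finite (collision_times a b)"
proof (rule ccontr)
  assume inf: "infinite (collision_times a b)"
  have "collision_times a b \<subseteq> {a..b}" by (auto simp: collision_times_def)
  then obtain T where T: "T islimpt collision_times a b"
    using inf compact_Icc[of a b] unfolding compact_eq_Bolzano_Weierstrass by meson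
  obtain \<epsilon> where eps: "\<epsilon> > 0" "\<And>s s' j k p q. \<bar>s - T\<bar> < \<epsilon> \<Longrightarrow> \<bar>s' - T\<bar> < \<epsilon> \<Longrightarrow> j < n \<Longrightarrow> k < n \<Longrightarrow>
     p < n \<Longrightarrow> q < n \<Longrightarrow> collide d x j k s \<Longrightarrow> collide d x p q s' \<Longrightarrow> s = s'"
    using locally_single_collision[of T] by blast
  have "infinite (collision_times a b \<inter> ball T \<epsilon>)"
    using T eps(1) islimpt_eq_infinite_ball by blast
  moreover have "s = s'" if "s \<in> collision_times a b \<inter> ball T \<epsilon>" "s' \<in> collision_times a b \<inter> ball T \<epsilon>" for s s'
    using that eps(2)[of s s'] by (auto simp: collision_times_def dist_real_def abs_minus_commute)
  ultimately show False
    by (metis finite.emptyI finite.insertI finite_subset insertI1 subsetI)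
qed

text \<open>The evolution describes velocities on open intervals, not at a single instant.
  Finiteness of the collision times supplies a neighbourhood of \<open>t\<close> without collisions
  of ball \<open>k\<close>, in which the motion is one straight line.\<close>

lemma velocity_unchanged:
  assumes k: "k < n" and no: "\<And>j. j < n \<Longrightarrow> \<not> collide d x j k t" and i: "i < d"
  shows "vel_before x k t i = vel_after x k t i"
proof -
  have "finite (collision_times (t - 1) (t + 1) - {t})" using finite_collision_times by simp
  from finite_set_avoid[OF this, of t]
  obtain \<epsilon> where eps: "\<epsilon> > 0" "\<And>u. u \<in> collision_times (t - 1) (t + 1) - {t} \<Longrightarrow> u \<noteq> t \<Longrightarrow> \<epsilon> \<le> dist t u"
    by auto
  define h where "h = min \<epsilon> 1"
  have h: "h > 0" using eps(1) by (simp add: h_def)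
  have free: "\<not> collide d x j k u" if "t - h < u" "u < t + h" "j < n" for j u
  proof
    assume c: "collide d x j k u"
    then have "u \<noteq> t" using no that by auto
    moreover have "u \<in> collision_times (t - 1) (t + 1)"
      using c that k by (auto simp: collision_times_def h_def)
    ultimately have "\<epsilon> \<le> dist t u" using eps(2) by auto
    then show False using that by (auto simp: dist_real_def h_def)
  qed
  have lin: "x k s i = x k (t - h) i + (s - (t - h)) * vel_after x k (t - h) i" if "s \<in> {t - h..t + h}" for s
    by (rule free_flight_position[OF k _ _ i that]) (use h free in auto)
  have "vel_before x k t i = vel_after x k (t - h) i"
    by (rule free_flight_velocity[OF k _ _ i]) (use h free in auto)
  moreover have "vel_after x k t i = vel_after x k (t - h) i" unfolding vel_after_def[of x k t]
  proof (rule linear_right_derivative[of t "t + h"])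
    fix s assume "s \<in> {t..t + h}"
    then show "x k s i = x k t i + (s - t) * vel_after x k (t - h) i"
      using lin[of s] lin[of t] h by (simp add: algebra_simps)
  qed (use h in simp)
  ultimately show ?thesis by simp
qed

end

section \<open>Isolated subsystems\<close>

lemma dot_eq_ip: "dot d u w = ip {..<d} u w"
  by (simp add: dot_def ip_def)

lemma centred_line:
  assumes "\<And>k i. k \<in> S \<Longrightarrow> i < d \<Longrightarrow> f k i = g k i + c * h k i" and "p \<in> S \<times> {..<d}"
  shows "centred S f p = centred S g p + c * centred S h p"
proof -
  obtain k i where p: "p = (k, i)" "k \<in> S" "i < d" using assms(2) by auto
  have "(\<Sum>l\<in>S. f l i) = (\<Sum>l\<in>S. g l i) + c * (\<Sum>l\<in>S. h l i)"
    using assms(1) p(3) by (simp add: sum.distrib sum_distrib_left)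
  then show ?thesis using assms(1)[OF p(2,3)] p(1)
    by (simp add: centred_def add_divide_distrib algebra_simps)
qed

lemma centred_cong:
  assumes "\<And>k i. k \<in> S \<Longrightarrow> i < d \<Longrightarrow> f k i = g k i" and "p \<in> S \<times> {..<d}"
  shows "centred S f p = centred S g p"
  using centred_line[of S d f g 0 g p] assms by simp

lemma L2_set_component_le:
  assumes "finite S" "k \<in> S"
  shows "L2_set (\<lambda>i. f (k, i)) {..<d} \<le> sqrt (ip (S \<times> {..<d}) f f)"
proof -
  have "(\<Sum>i<d. (f (k, i))\<^sup>2) \<le> (\<Sum>l\<in>S. \<Sum>i<d. (f (l, i))\<^sup>2)"
    by (rule member_le_sum[OF assms(2)]) (auto simp: assms sum_nonneg)
  also have "\<dots> = ip (S \<times> {..<d}) f f"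
    unfolding ip_def sum.cartesian_product by (simp add: power2_eq_square split_def)
  finally show ?thesis unfolding L2_set_def by simp
qed

lemma L2_set_diff_le:
  assumes "finite S" "j \<in> S" "k \<in> S" "ip (S \<times> {..<d}) f f = r\<^sup>2" "0 \<le> r"
  shows "L2_set (\<lambda>i. f (j, i) - f (k, i)) {..<d} \<le> 2 * r"
proof -
  have "L2_set (\<lambda>i. f (j, i) + - f (k, i)) {..<d}
      \<le> L2_set (\<lambda>i. f (j, i)) {..<d} + L2_set (\<lambda>i. - f (k, i)) {..<d}"
    by (rule L2_set_triangle_ineq)
  also have "L2_set (\<lambda>i. - f (k, i)) {..<d} = L2_set (\<lambda>i. f (k, i)) {..<d}"
    by (simp add: L2_set_def)
  finally show ?thesis
    using L2_set_component_le[OF assms(1,2), of f d] L2_set_component_le[OF assms(1,3), of f d] assms(4,5) by simp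
qed

context separated_evolution
begin

definition isolated :: "nat set \<Rightarrow> real \<Rightarrow> real \<Rightarrow> bool" where
  "isolated S a b \<longleftrightarrow> S \<subseteq> {..<n} \<and> S \<noteq> {} \<and>
     (\<forall>t\<in>{a..b}. \<forall>j\<in>S. \<forall>k<n. collide d x j k t \<longrightarrow> k \<in> S)"

definition inner_times :: "nat set \<Rightarrow> real \<Rightarrow> real \<Rightarrow> real set" where
  "inner_times S a b = {t \<in> {a..b}. \<exists>j\<in>S. \<exists>k\<in>S. collide d x j k t}"

definition pos :: "nat set \<Rightarrow> real \<Rightarrow> nat \<times> nat \<Rightarrow> real" where
  "pos S t = centred S (\<lambda>k. x k t)"

text \<open>Velocities after collisions give the right-continuous description of the motion. The
  left-continuous \<open>vel_pre\<close> takes its place when time is reversed.\<close>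

definition vel :: "nat set \<Rightarrow> real \<Rightarrow> nat \<times> nat \<Rightarrow> real" where
  "vel S t = centred S (\<lambda>k. vel_after x k t)"

definition vel_pre :: "nat set \<Rightarrow> real \<Rightarrow> nat \<times> nat \<Rightarrow> real" where
  "vel_pre S t = centred S (\<lambda>k. vel_before x k t)"

lemma isolatedD: "isolated S a b \<Longrightarrow> finite S" "isolated S a b \<Longrightarrow> S \<noteq> {}"
  "isolated S a b \<Longrightarrow> k \<in> S \<Longrightarrow> k < n"
  by (auto simp: isolated_def finite_subset)

lemma isolated_subinterval: "isolated S a b \<Longrightarrow> a \<le> a' \<Longrightarrow> b' \<le> b \<Longrightarrow> isolated S a' b'"
  by (fastforce simp: isolated_def)

lemma finite_inner_times:
  assumes "isolated S a b" shows "finite (inner_times S a b)"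
  by (rule finite_subset[OF _ finite_collision_times[of a b]])
     (use isolatedD[OF assms] in \<open>auto simp: inner_times_def collision_times_def\<close>)

lemma collides_inside:
  assumes iso: "isolated S a b" and t: "t \<in> {a..b}" and k: "k \<in> S" and j: "j < n" and c: "collide d x j k t"
  shows "j \<in> S" "t \<in> inner_times S a b"
proof -
  have "collide d x k j t" using c by (simp add: collide_commute)
  then show "j \<in> S" using iso t k j by (auto simp: isolated_def)
  then show "t \<in> inner_times S a b" using c t k by (auto simp: inner_times_def)
qed

lemma
  assumes iso: "isolated S a b" and ab: "a \<le> a'" "a' < b'" "b' \<le> b"
    and free: "inner_times S a b \<inter> {a'<..<b'} = {}"
    and ki: "k \<in> S" "i < d"
  shows inner_flight_position: "\<And>s. s \<in> {a'..b'} \<Longrightarrow> x k s i = x k a' i + (s - a') * vel_after x k a' i"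
    and inner_flight_velocity: "vel_before x k b' i = vel_after x k a' i"
proof -
  have k: "k < n" using isolatedD(3)[OF iso ki(1)] .
  have nc: "\<not> collide d x j k t" if "a' < t" "t < b'" "j < n" for t j
    using collides_inside(2)[OF iso _ ki(1) that(3), of t] free that ab by fastforce
  show "x k s i = x k a' i + (s - a') * vel_after x k a' i" if "s \<in> {a'..b'}" for s
    using free_flight_position[OF k ab(2) nc ki(2) that] by simp
  show "vel_before x k b' i = vel_after x k a' i"
    using free_flight_velocity[OF k ab(2) nc ki(2)] by simp
qed

lemma pos_line:
  assumes "isolated S a b" "a \<le> a'" "a' < b'" "b' \<le> b" "inner_times S a b \<inter> {a'<..<b'} = {}"
    and "s \<in> {a'..b'}" "p \<in> S \<times> {..<d}"
  shows "pos S s p = pos S a' p + (s - a') * vel S a' p"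
  unfolding pos_def vel_def
  by (rule centred_line[OF _ assms(7)]) (rule inner_flight_position[OF assms(1-5) _ _ assms(6)])

lemma vel_pre_eq:
  assumes "isolated S a b" "a \<le> a'" "a' < b'" "b' \<le> b" "inner_times S a b \<inter> {a'<..<b'} = {}"
    and "p \<in> S \<times> {..<d}"
  shows "vel_pre S b' p = vel S a' p"
  unfolding vel_pre_def vel_def
  by (rule centred_cong[OF _ assms(6)]) (rule inner_flight_velocity[OF assms(1-5)])

text \<open>With \<open>e\<close> the unit vector from ball \<open>k\<close> to ball
  \<open>j\<close> and \<open>g\<close> their speed of approach, the collision adds
  \<open>g * e\<close> to one velocity and subtracts it from the other. Momentum cancels, the energy
  changes by \<open>2 * g\<^sup>2 - 2 * g\<^sup>2\<close>, and the radial product gains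
  \<open>2 * g\<close>, since the centres are at distance 2.\<close>

lemma
  assumes iso: "isolated S a b" and t: "t \<in> {a..b}"
  shows energy_jump: "ip (S \<times> {..<d}) (vel S t) (vel S t) = ip (S \<times> {..<d}) (vel_pre S t) (vel_pre S t)"
    and radial_jump: "ip (S \<times> {..<d}) (pos S t) (vel_pre S t) \<le> ip (S \<times> {..<d}) (pos S t) (vel S t)"
proof -
  let ?I = "S \<times> {..<d}"
  let ?va = "\<lambda>k. vel_after x k t" and ?vb = "\<lambda>k. vel_before x k t" and ?x = "\<lambda>k. x k t"
  note S = isolatedD[OF iso]
  have goal: "ip ?I (vel S t) (vel S t) = ip ?I (vel_pre S t) (vel_pre S t) \<and>
      ip ?I (pos S t) (vel_pre S t) \<le> ip ?I (pos S t) (vel S t)"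
    if mom: "\<And>i. i < d \<Longrightarrow> (\<Sum>l\<in>S. ?va l i) = (\<Sum>l\<in>S. ?vb l i)"
      and en: "(\<Sum>k\<in>S. dot d (?va k) (?va k)) = (\<Sum>k\<in>S. dot d (?vb k) (?vb k))"
      and rad: "(\<Sum>k\<in>S. dot d (?x k) (?vb k)) \<le> (\<Sum>k\<in>S. dot d (?x k) (?va k))"
    unfolding vel_def vel_pre_def pos_def ip_centred[OF S(1,2)]
    using mom en rad by simp
  show "ip ?I (vel S t) (vel S t) = ip ?I (vel_pre S t) (vel_pre S t)"
    and "ip ?I (pos S t) (vel_pre S t) \<le> ip ?I (pos S t) (vel S t)"
  proof (atomize(full), cases "t \<in> inner_times S a b")
    case False
    have "?vb k i = ?va k i" if "k \<in> S" "i < d" for k i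
      by (rule velocity_unchanged[OF S(3)[OF that(1)] _ that(2)])
         (use collides_inside(2)[OF iso t that(1)] False in blast)
    then show "ip ?I (vel S t) (vel S t) = ip ?I (vel_pre S t) (vel_pre S t) \<and>
      ip ?I (pos S t) (vel_pre S t) \<le> ip ?I (pos S t) (vel S t)"
      by (intro goal) (simp_all add: dot_def)
  next
    case True
    then obtain j k where jk: "j \<in> S" "k \<in> S" "collide d x j k t" by (auto simp: inner_times_def)
    have nj: "j < n" "k < n" "j \<noteq> k" using jk S(3) collide_imp_neq by auto
    have cd: "centre_dist d x j k t = 2" using jk(3) by (simp add: collide_def in_contact_def)
    define e where "e i = (x j t i - x k t i) / 2" for i
    define g where "g = dot d (?vb k) e - dot d (?vb j) e"
    have el: "dot d (\<lambda>i. ?vb j i - ?vb k i) (\<lambda>i. x j t i - x k t i) < 0"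
      "\<And>i. i < d \<Longrightarrow> ?va j i = ?vb j i + g * e i"
      "\<And>i. i < d \<Longrightarrow> ?va k i = ?vb k i + (- g) * e i"
      using elastic[OF jk(3) nj(1,2)] cd
      by (auto simp: elastic_law_def Let_def e_def[abs_def] g_def algebra_simps)
    have ee: "dot d e e = 1"
      using centre_dist_sq[of d x j k t] cd
      by (simp add: dot_def e_def power2_eq_square sum_divide_distrib[symmetric])
    have g: "0 < g"
    proof -
      have "g = - dot d (\<lambda>i. ?vb j i - ?vb k i) (\<lambda>i. x j t i - x k t i) / 2"
        by (simp add: g_def dot_def e_def sum_subtractf[symmetric] sum_divide_distrib
            sum_negf[symmetric] algebra_simps diff_divide_distrib add_divide_distrib)
      then show ?thesis using el(1) by simp
    qed
    have xe: "dot d (?x j) e - dot d (?x k) e = 2"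
    proof -
      have "dot d (?x j) e - dot d (?x k) e = 2 * dot d e e"
        by (simp add: dot_def e_def sum_subtractf[symmetric] sum_distrib_left algebra_simps diff_divide_distrib)
      then show ?thesis by (simp add: ee)
    qed
    \<comment> \<open>While \<open>j\<close> and \<open>k\<close> collide, \<open>sep\<close> keeps
      every other pair out of contact, so no other ball changes velocity at
      \<open>t\<close>.\<close>
    have other: "?va l i = ?vb l i" if "l \<in> S" "l \<noteq> j" "l \<noteq> k" "i < d" for l i
    proof (rule velocity_unchanged[OF S(3)[OF that(1)] _ that(4), symmetric])
      fix q assume q: "q < n"
      show "\<not> collide d x q l t"
      proof
        assume c: "collide d x q l t"
        have "\<delta> < ball_dist d x q l t"
          by (rule sep[OF jk(3) nj(1,2) q S(3)[OF that(1)] collide_imp_neq[OF c]]) (use that in auto)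
        then show False using c delta_pos by (simp add: collide_def in_contact_def ball_dist_def)
      qed
    qed
    have dva: "dot d f (?va j) = dot d f (?vb j) + g * dot d f e"
      "dot d f (?va k) = dot d f (?vb k) - g * dot d f e" for f
    proof -
      have "dot d f (?va j) = ip {..<d} f (\<lambda>i. ?vb j i + g * e i)"
        unfolding dot_eq_ip using el(2) by (intro ip_cong) auto
      then show "dot d f (?va j) = dot d f (?vb j) + g * dot d f e"
        by (simp add: ip_add_scaled_right dot_eq_ip)
      have "dot d f (?va k) = ip {..<d} f (\<lambda>i. ?vb k i + (- g) * e i)"
        unfolding dot_eq_ip using el(3) by (intro ip_cong) auto
      then show "dot d f (?va k) = dot d f (?vb k) - g * dot d f e"
        unfolding ip_add_scaled_right dot_eq_ip by simp
    qed
    have dvv: "dot d (?va j) (?va j) = dot d (?vb j) (?vb j) + 2 * g * dot d (?vb j) e + g\<^sup>2"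
      "dot d (?va k) (?va k) = dot d (?vb k) (?vb k) - 2 * g * dot d (?vb k) e + g\<^sup>2"
    proof -
      have c: "dot d u w = dot d w u" for u w by (simp add: dot_eq_ip ip_commute)
      show "dot d (?va j) (?va j) = dot d (?vb j) (?vb j) + 2 * g * dot d (?vb j) e + g\<^sup>2"
        using dva(1)[of "?va j"] dva(1)[of "?vb j"] dva(1)[of e] c[of "?va j" "?vb j"] c[of "?va j" e] c[of e "?vb j"] ee
        by (simp add: power2_eq_square algebra_simps)
      show "dot d (?va k) (?va k) = dot d (?vb k) (?vb k) - 2 * g * dot d (?vb k) e + g\<^sup>2"
        using dva(2)[of "?va k"] dva(2)[of "?vb k"] dva(2)[of e] c[of "?va k" "?vb k"] c[of "?va k" e] c[of e "?vb k"] ee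
        by (simp add: power2_eq_square algebra_simps)
    qed
    show "ip ?I (vel S t) (vel S t) = ip ?I (vel_pre S t) (vel_pre S t) \<and>
      ip ?I (pos S t) (vel_pre S t) \<le> ip ?I (pos S t) (vel S t)"
    proof (rule goal)
      fix i assume i: "i < d"
      have "(\<Sum>l\<in>S. ?va l i) = (\<Sum>l\<in>S. ?vb l i) + (?va j i - ?vb j i) + (?va k i - ?vb k i)"
        by (rule sum_change_two[OF S(1) jk(1,2) nj(3)]) (use other i in auto)
      then show "(\<Sum>l\<in>S. ?va l i) = (\<Sum>l\<in>S. ?vb l i)" using el(2,3)[OF i] by simp
    next
      have "(\<Sum>l\<in>S. dot d (?va l) (?va l)) = (\<Sum>l\<in>S. dot d (?vb l) (?vb l))
          + (dot d (?va j) (?va j) - dot d (?vb j) (?vb j)) + (dot d (?va k) (?va k) - dot d (?vb k) (?vb k))"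
        by (rule sum_change_two[OF S(1) jk(1,2) nj(3)]) (use other in \<open>auto simp: dot_def\<close>)
      moreover have "g * dot d (?vb k) e - g * dot d (?vb j) e = g\<^sup>2"
        by (simp add: g_def power2_eq_square algebra_simps)
      ultimately show "(\<Sum>l\<in>S. dot d (?va l) (?va l)) = (\<Sum>l\<in>S. dot d (?vb l) (?vb l))"
        unfolding dvv by linarith
    next
      have "(\<Sum>l\<in>S. dot d (?x l) (?va l)) = (\<Sum>l\<in>S. dot d (?x l) (?vb l))
          + (dot d (?x j) (?va j) - dot d (?x j) (?vb j)) + (dot d (?x k) (?va k) - dot d (?x k) (?vb k))"
        by (rule sum_change_two[OF S(1) jk(1,2) nj(3)]) (use other in \<open>auto simp: dot_def\<close>)
      moreover have "g * dot d (?x j) e - g * dot d (?x k) e = g * 2"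
        using xe by (simp add: algebra_simps flip: right_diff_distrib)
      ultimately show "(\<Sum>l\<in>S. dot d (?x l) (?vb l)) \<le> (\<Sum>l\<in>S. dot d (?x l) (?va l))"
        unfolding dva using g by linarith
    qed
  qed
qed

lemma energy_constant:
  assumes iso: "isolated S a b"
  obtains r where "0 \<le> r"
    "\<And>t. t \<in> {a..b} \<Longrightarrow> ip (S \<times> {..<d}) (vel S t) (vel S t) = r\<^sup>2"
    "\<And>t. t \<in> {a..b} \<Longrightarrow> ip (S \<times> {..<d}) (vel_pre S t) (vel_pre S t) = r\<^sup>2"
proof -
  define E where "E t = ip (S \<times> {..<d}) (vel S t) (vel S t)" for t
  have E: "E t = E a" if "a < t" "t \<le> b" for t
  proof (rule interval_induct[where P = "\<lambda>a b. E b = E a", OF finite_inner_times[OF iso]])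
    fix a' b' assume h: "a \<le> a'" "a' < b'" "b' \<le> b" "inner_times S a b \<inter> {a'<..<b'} = {}"
    have "E b' = ip (S \<times> {..<d}) (vel_pre S b') (vel_pre S b')"
      unfolding E_def by (rule energy_jump[OF iso]) (use h in auto)
    also have "\<dots> = E a'" unfolding E_def
      by (rule ip_cong; rule vel_pre_eq[OF iso h])
    finally show "E b' = E a'" .
  qed (use that in auto)
  have "0 \<le> E a" by (simp add: E_def ip_self_nonneg)
  then have sq: "E a = (sqrt (E a))\<^sup>2" by simp
  have all: "E t = (sqrt (E a))\<^sup>2" if "t \<in> {a..b}" for t
    using E[of t] that sq by (cases "t = a") auto
  show thesis
  proof (rule that)
    show "0 \<le> sqrt (E a)" using \<open>0 \<le> E a\<close> by simp
    show "ip (S \<times> {..<d}) (vel S t) (vel S t) = (sqrt (E a))\<^sup>2" if "t \<in> {a..b}" for t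
      using all[OF that] by (simp add: E_def)
    show "ip (S \<times> {..<d}) (vel_pre S t) (vel_pre S t) = (sqrt (E a))\<^sup>2" if "t \<in> {a..b}" for t
      using all[OF that] energy_jump[OF iso that] by (simp add: E_def)
  qed
qed

lemma centre_dist_pos:
  "centre_dist d x j k t = L2_set (\<lambda>i. pos S t (j, i) - pos S t (k, i)) {..<d}"
  by (simp add: centre_dist_def pos_def centred_def)

text \<open>Relative to the centre of mass each ball moves at speed at most \<open>r\<close>, so two
  of them approach or recede at speed at most \<open>2 * r\<close>.\<close>

lemma centre_dist_Lipschitz:
  assumes iso: "isolated S a b" and jk: "j \<in> S" "k \<in> S" and r: "0 \<le> r"
    and E: "\<And>t. t \<in> {a..b} \<Longrightarrow> ip (S \<times> {..<d}) (vel S t) (vel S t) = r\<^sup>2"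
    and st: "a \<le> s" "s \<le> t" "t \<le> b"
  shows "\<bar>centre_dist d x j k t - centre_dist d x j k s\<bar> \<le> 2 * r * (t - s)"
proof (cases "s = t")
  case False
  note S = isolatedD[OF iso]
  have st': "a \<le> s" "s < t" "t \<le> b" using st False by auto
  show ?thesis
  proof (rule interval_induct[where P = "\<lambda>s t. \<bar>centre_dist d x j k t - centre_dist d x j k s\<bar> \<le> 2 * r * (t - s)",
       OF finite_inner_times[OF iso] _ _ st'])
    fix a' b' assume h: "a \<le> a'" "a' < b'" "b' \<le> b" "inner_times S a b \<inter> {a'<..<b'} = {}"
    define y where "y t i = pos S t (j, i) - pos S t (k, i)" for t i
    define v where "v i = vel S a' (j, i) - vel S a' (k, i)" for i
    have lin: "y b' i = y a' i + (b' - a') * v i" if "i < d" for i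
      using pos_line[OF iso h, of b' "(j, i)"] pos_line[OF iso h, of b' "(k, i)"] jk that h
      by (simp add: y_def v_def algebra_simps)
    have cd: "centre_dist d x j k t = L2_set (y t) {..<d}" for t
      unfolding y_def by (rule centre_dist_pos)
    have v: "L2_set v {..<d} \<le> 2 * r"
      unfolding v_def by (rule L2_set_diff_le[OF S(1) jk E r]) (use h in auto)
    have sc: "L2_set (\<lambda>i. c * v i) {..<d} \<le> \<bar>c\<bar> * (2 * r)" for c
    proof -
      have "L2_set (\<lambda>i. c * v i) {..<d} = \<bar>c\<bar> * L2_set v {..<d}"
        unfolding L2_set_def by (simp add: power_mult_distrib sum_distrib_left[symmetric] real_sqrt_mult)
      then show ?thesis using v by (simp add: mult_left_mono)
    qed
    have "L2_set (y b') {..<d} = L2_set (\<lambda>i. y a' i + (b' - a') * v i) {..<d}"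
      using lin by (intro L2_set_cong) auto
    also have "\<dots> \<le> L2_set (y a') {..<d} + L2_set (\<lambda>i. (b' - a') * v i) {..<d}"
      by (rule L2_set_triangle_ineq)
    finally have 1: "L2_set (y b') {..<d} \<le> L2_set (y a') {..<d} + (b' - a') * (2 * r)"
      using sc[of "b' - a'"] h by simp
    have "L2_set (y a') {..<d} = L2_set (\<lambda>i. y b' i + (- (b' - a')) * v i) {..<d}"
      by (intro L2_set_cong) (auto simp: lin algebra_simps)
    also have "\<dots> \<le> L2_set (y b') {..<d} + L2_set (\<lambda>i. (- (b' - a')) * v i) {..<d}"
      by (rule L2_set_triangle_ineq)
    finally have 2: "L2_set (y a') {..<d} \<le> L2_set (y b') {..<d} + (b' - a') * (2 * r)"
      using sc[of "- (b' - a')"] h by simp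
    show "\<bar>centre_dist d x j k b' - centre_dist d x j k a'\<bar> \<le> 2 * r * (b' - a')"
      unfolding cd using 1 2 by (simp add: abs_le_iff algebra_simps)
  next
    fix a' b' c :: real
    assume "\<bar>centre_dist d x j k b' - centre_dist d x j k a'\<bar> \<le> 2 * r * (b' - a')"
      "\<bar>centre_dist d x j k c - centre_dist d x j k b'\<bar> \<le> 2 * r * (c - b')"
    then show "\<bar>centre_dist d x j k c - centre_dist d x j k a'\<bar> \<le> 2 * r * (c - a')"
      by (simp only: right_diff_distrib abs_le_iff) linarith
  qed
qed simp

text \<open>With zero energy all relative velocities vanish, against the strict approach demanded by
  \<open>elastic_law\<close>.\<close>

lemma collision_needs_energy:
  assumes iso: "isolated S a b" and t: "t \<in> {a..b}" and c: "collide d x j k t" "j \<in> S" "k \<in> S"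
    and E: "ip (S \<times> {..<d}) (vel_pre S t) (vel_pre S t) = r\<^sup>2"
  shows "r \<noteq> 0"
proof
  assume "r = 0"
  note S = isolatedD[OF iso]
  have "L2_set (\<lambda>i. vel_pre S t (j, i) - vel_pre S t (k, i)) {..<d} \<le> 2 * 0"
    by (rule L2_set_diff_le[OF S(1) c(2,3)]) (use E \<open>r = 0\<close> in auto)
  then have "L2_set (\<lambda>i. vel_pre S t (j, i) - vel_pre S t (k, i)) {..<d} = 0"
    using L2_set_nonneg[of "\<lambda>i. vel_pre S t (j, i) - vel_pre S t (k, i)" "{..<d}"] by linarith
  then have "\<forall>i<d. vel_before x j t i - vel_before x k t i = 0"
    by (simp add: L2_set_eq_0_iff vel_pre_def centred_def)
  then have "dot d (\<lambda>i. vel_before x j t i - vel_before x k t i) (\<lambda>i. x j t i - x k t i) = 0"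
    by (simp add: dot_def)
  then show False using elastic[OF c(1) S(3)[OF c(2)] S(3)[OF c(3)]] by (simp add: elastic_law_def Let_def)
qed

text \<open>Some pair must change its distance by at least \<open>\<delta>\<close> in the meantime.
  For different pairs it is the second one, which is beyond \<open>\<delta>\<close> at time
  \<open>s\<close>. If one pair collides twice, \<open>recollision_needs_third_ball\<close> gives an
  intermediate collision of another pair, at which \<open>j\<close> and \<open>k\<close> are beyond
  \<open>\<delta>\<close>.\<close>

lemma collision_time_gap:
  assumes iso: "isolated S a b" and r: "0 \<le> r"
    and E: "\<And>t. t \<in> {a..b} \<Longrightarrow> ip (S \<times> {..<d}) (vel S t) (vel S t) = r\<^sup>2"
    and c: "collide d x j k s" "j \<in> S" "k \<in> S" "collide d x p q s'" "p \<in> S" "q \<in> S"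
    and ss: "a \<le> s" "s < s'" "s' \<le> b"
  shows "\<delta> \<le> 2 * r * (s' - s)"
proof -
  note S = isolatedD(3)[OF iso]
  show ?thesis
  proof (cases "{p, q} = {j, k}")
    case True
    then have "j = p \<and> k = q \<or> j = q \<and> k = p" by (auto simp: doubleton_eq_iff)
    then have "collide d x j k s'" using c(4) collide_commute by blast
    from recollision_needs_third_ball[OF c(1) this ss(2) S[OF c(2)] S[OF c(3)]]
    obtain u p' q' where u: "s < u" "u < s'" "p' < n" "q' < n" "collide d x p' q' u" "{p', q'} \<noteq> {j, k}"
      by blast
    have "\<delta> < ball_dist d x j k u"
      by (rule sep[OF u(5,3,4) S[OF c(2)] S[OF c(3)] collide_imp_neq[OF c(1)]]) (use u(6) in auto)
    moreover have "ball_dist d x j k s = 0"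
      using c(1) by (simp add: ball_dist_def collide_def in_contact_def)
    moreover have "\<bar>centre_dist d x j k u - centre_dist d x j k s\<bar> \<le> 2 * r * (u - s)"
      by (rule centre_dist_Lipschitz[OF iso c(2,3) r E]) (use u ss in auto)
    moreover have "2 * r * (u - s) \<le> 2 * r * (s' - s)" using u r by (intro mult_left_mono) auto
    ultimately show ?thesis unfolding ball_dist_def by linarith
  next
    case False
    have "\<delta> < ball_dist d x p q s"
      by (rule sep[OF c(1) S[OF c(2)] S[OF c(3)] S[OF c(5)] S[OF c(6)] collide_imp_neq[OF c(4)] False])
    moreover have "ball_dist d x p q s' = 0"
      using c(4) by (simp add: ball_dist_def collide_def in_contact_def)
    moreover have "\<bar>centre_dist d x p q s' - centre_dist d x p q s\<bar> \<le> 2 * r * (s' - s)"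
      by (rule centre_dist_Lipschitz[OF iso c(5,6) r E]) (use ss in auto)
    ultimately show ?thesis unfolding ball_dist_def by linarith
  qed
qed

end

section \<open>Splitting a configuration\<close>

text \<open>A negative radial product would make the norm decrease right after
  \<open>t0\<close>.\<close>

lemma minimum_radial_velocity:
  fixes Z V :: "real \<Rightarrow> 'i \<Rightarrow> real"
  assumes C: "finite C" and r: "0 < r" and t0: "t0 < T"
    and lin: "\<And>a b s i. t0 \<le> a \<Longrightarrow> a < b \<Longrightarrow> b \<le> T \<Longrightarrow> C \<inter> {a<..<b} = {} \<Longrightarrow>
        s \<in> {a..b} \<Longrightarrow> i \<in> I \<Longrightarrow> Z s i = Z a i + (s - a) * V a i"
    and en: "ip I (V t0) (V t0) = r\<^sup>2"
    and mini: "\<And>t. t0 \<le> t \<Longrightarrow> t \<le> T \<Longrightarrow> ip I (Z t0) (Z t0) \<le> ip I (Z t) (Z t)"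
  shows "0 \<le> ip I (Z t0) (V t0)"
proof (rule ccontr)
  define p where "p = ip I (Z t0) (V t0)"
  assume "\<not> ?thesis"
  then have p: "p < 0" by (simp add: p_def)
  obtain \<epsilon> where eps: "\<epsilon> > 0" "\<And>c. c \<in> C \<Longrightarrow> c \<noteq> t0 \<Longrightarrow> \<epsilon> \<le> dist t0 c"
    using finite_set_avoid[OF C, of t0] by blast
  \<comment> \<open>The bound \<open>- p / r\<^sup>2\<close> lets the negative linear term
    \<open>2 * h * p\<close> outweigh the quadratic one. The other two keep the step on the first
    linear piece and before \<open>T\<close>.\<close>
  define h where "h = min (min \<epsilon> (T - t0)) (- p / r\<^sup>2)"
  have h: "0 < h" "h \<le> \<epsilon>" "h \<le> T - t0" "h \<le> - p / r\<^sup>2"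
    using eps(1) t0 p r by (auto simp: h_def divide_neg_pos)
  have free: "C \<inter> {t0<..<t0 + h} = {}" using eps(2) h(2) by (force simp: dist_real_def)
  have "ip I (Z (t0 + h)) (Z (t0 + h)) = ip I (\<lambda>i. Z t0 i + h * V t0 i) (\<lambda>i. Z t0 i + h * V t0 i)"
    using lin[OF order_refl _ _ free, of "t0 + h"] h by (intro ip_cong) auto
  also have "\<dots> = ip I (Z t0) (Z t0) + 2 * h * p + h\<^sup>2 * r\<^sup>2"
    unfolding ip_line en p_def ..
  finally have "0 \<le> h * (2 * p + h * r\<^sup>2)"
    using mini[of "t0 + h"] h by (simp add: algebra_simps power2_eq_square)
  moreover have "h * r\<^sup>2 \<le> - p" using h(4) r by (simp add: field_simps)
  then have "h * (2 * p + h * r\<^sup>2) < 0" using p h(1) by (intro mult_pos_neg) auto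
  ultimately show False by simp
qed

text \<open>Minimality replaces the sign condition of the broken line estimates. The case of a
  single time \<open>t0 = T\<close> is separate, because a minimum there says nothing about the
  velocity.\<close>

lemma
  fixes Z V :: "real \<Rightarrow> 'i \<Rightarrow> real"
  assumes C: "finite C" and R: "0 < R" and r: "0 < r"
    and lin: "\<And>a b s i. t0 \<le> a \<Longrightarrow> a < b \<Longrightarrow> b \<le> T \<Longrightarrow> C \<inter> {a<..<b} = {} \<Longrightarrow>
        s \<in> {a..b} \<Longrightarrow> i \<in> I \<Longrightarrow> Z s i = Z a i + (s - a) * V a i"
    and jump: "\<And>a b. t0 \<le> a \<Longrightarrow> a < b \<Longrightarrow> b \<le> T \<Longrightarrow> C \<inter> {a<..<b} = {} \<Longrightarrow>
        ip I (Z b) (V a) \<le> ip I (Z b) (V b)"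
    and en: "\<And>t. t0 \<le> t \<Longrightarrow> t \<le> T \<Longrightarrow> ip I (V t) (V t) = r\<^sup>2"
    and Z0: "ip I (Z t0) (Z t0) = R\<^sup>2"
    and mini: "\<And>t. t0 \<le> t \<Longrightarrow> t \<le> T \<Longrightarrow> ip I (Z t0) (Z t0) \<le> ip I (Z t) (Z t)"
  shows growth_from_minimum: "\<And>t. t0 \<le> t \<Longrightarrow> t \<le> T \<Longrightarrow> R\<^sup>2 + (r * (t - t0))\<^sup>2 \<le> ip I (Z t) (Z t)"
    and turning_from_minimum: "\<And>s t w. t0 \<le> s \<Longrightarrow> s \<le> t \<Longrightarrow> t \<le> T \<Longrightarrow>
      \<bar>ip I w (Z t) / sqrt (ip I (Z t) (Z t)) - ip I w (Z s) / sqrt (ip I (Z s) (Z s))\<bar>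
      \<le> sqrt (ip I w w) * (turn R r (t - t0) - turn R r (s - t0))"
proof -
  have p0: "0 \<le> ip I (Z t0) (V t0)" if "t0 < T"
    by (rule minimum_radial_velocity[OF C r that lin en mini]) (use that in auto)
  show "R\<^sup>2 + (r * (t - t0))\<^sup>2 \<le> ip I (Z t) (Z t)" if t: "t0 \<le> t" "t \<le> T" for t
  proof (cases "t0 < T")
    case True
    show ?thesis by (rule broken_line_growth[OF C R r lin jump en Z0 p0[OF True] t])
  next
    case False
    then have "t = t0" using t by simp
    then show ?thesis using Z0 by simp
  qed
  show "\<bar>ip I w (Z t) / sqrt (ip I (Z t) (Z t)) - ip I w (Z s) / sqrt (ip I (Z s) (Z s))\<bar>
      \<le> sqrt (ip I w w) * (turn R r (t - t0) - turn R r (s - t0))"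
    if t: "t0 \<le> s" "s \<le> t" "t \<le> T" for s t w
  proof (cases "t0 < T")
    case True
    show ?thesis by (rule broken_line_turning[OF C R r lin jump en Z0 p0[OF True] t])
  next
    case False
    then have "s = t" using t by auto
    then show ?thesis by simp
  qed
qed

section \<open>Distant groups, separated times and test vectors\<close>

text \<open>If no splitting existed, every proper nonempty part of \<open>S\<close> could be
  enlarged by a point within \<open>l\<close> of it. Starting from \<open>j\<close>, this would
  exhaust \<open>S\<close> while each new point adds at most \<open>l\<close> to the distance from
  \<open>j\<close>, and \<open>k\<close> would be too close.\<close>

lemma cluster_split:
  fixes D :: "'a \<Rightarrow> 'a \<Rightarrow> real"
  assumes S: "finite S" and jk: "j \<in> S" "k \<in> S" and l: "0 \<le> l"
    and refl: "D j j = 0" and tri: "\<And>a b. a \<in> S \<Longrightarrow> b \<in> S \<Longrightarrow> D j b \<le> D j a + D a b"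
    and far: "real (card S) * l < D j k"
  shows "\<exists>A B. A \<union> B = S \<and> A \<inter> B = {} \<and> A \<noteq> {} \<and> B \<noteq> {} \<and> (\<forall>a\<in>A. \<forall>b\<in>B. l < D a b)"
proof (rule ccontr)
  assume no: "\<not> ?thesis"
  have link: "\<exists>a\<in>A. \<exists>b\<in>S - A. D a b \<le> l" if A: "A \<subseteq> S" "A \<noteq> {}" "A \<noteq> S" for A
  proof (rule ccontr)
    assume "\<not> ?thesis"
    then have "A \<union> (S - A) = S \<and> A \<inter> (S - A) = {} \<and> A \<noteq> {} \<and> S - A \<noteq> {} \<and>
        (\<forall>a\<in>A. \<forall>b\<in>S - A. l < D a b)"
      using A by (auto simp: not_le)
    then show False using no by blast
  qed
  have grow: "\<exists>A\<subseteq>S. card A = Suc r \<and> j \<in> A \<and> (\<forall>a\<in>A. D j a \<le> real r * l)" if "r < card S" for r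
    using that
  proof (induction r)
    case 0
    then show ?case using jk refl by (intro exI[of _ "{j}"]) auto
  next
    case (Suc r)
    then obtain A where A: "A \<subseteq> S" "card A = Suc r" "j \<in> A" "\<And>a. a \<in> A \<Longrightarrow> D j a \<le> real r * l" by auto
    then have "A \<noteq> S" "A \<noteq> {}" using Suc.prems by auto
    then obtain a b where ab: "a \<in> A" "b \<in> S - A" "D a b \<le> l" using link[OF A(1)] by blast
    have "D j b \<le> real r * l + l" using tri[of a b] A(4)[OF ab(1)] ab A(1) by force
    moreover have "D j c \<le> real r * l + l" if "c \<in> A" for c using A(4)[OF that] l by linarith
    moreover have "finite A" using A(1) S finite_subset by blast
    ultimately show ?case using A ab by (intro exI[of _ "insert b A"]) (auto simp: algebra_simps)
  qed
  have c: "0 < card S" using S jk by (auto simp: card_gt_0_iff)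
  then obtain A where A: "A \<subseteq> S" "card A = card S" "\<And>a. a \<in> A \<Longrightarrow> D j a \<le> real (card S - 1) * l"
    using grow[of "card S - 1"] by auto
  have "A = S" using card_subset_eq[OF S A(1,2)] .
  then have "D j k \<le> real (card S - 1) * l" using A(3) jk by auto
  also have "\<dots> \<le> real (card S) * l" using l by (intro mult_right_mono) auto
  finally show False using far by simp
qed

text \<open>Rounding down \<open>(t - c) / \<mu>\<close> is injective on \<open>T\<close>, with
  values between 0 and the floor of \<open>len / \<mu>\<close>.\<close>

lemma separated_card:
  fixes T :: "real set"
  assumes T: "T \<subseteq> {c..c + len}" and mu: "0 < \<mu>" and len: "0 \<le> len"
    and gap: "\<And>s t. s \<in> T \<Longrightarrow> t \<in> T \<Longrightarrow> s < t \<Longrightarrow> \<mu> \<le> t - s"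
  shows "real (card T) \<le> len / \<mu> + 1"
proof -
  define f where "f t = \<lfloor>(t - c) / \<mu>\<rfloor>" for t
  have less: "f s < f t" if "s \<in> T" "t \<in> T" "s < t" for s t
  proof -
    have "1 \<le> (t - s) / \<mu>" using gap[OF that] mu by simp
    moreover have "(t - s) / \<mu> = (t - c) / \<mu> - (s - c) / \<mu>" by (simp add: diff_divide_distrib)
    ultimately have "(s - c) / \<mu> + 1 \<le> (t - c) / \<mu>" by linarith
    then show ?thesis unfolding f_def by linarith
  qed
  have "inj_on f T" by (rule inj_onI) (metis less less_irrefl linorder_neqE_linordered_idom)
  moreover have "f ` T \<subseteq> {0..\<lfloor>len / \<mu>\<rfloor>}"
  proof (rule image_subsetI)
    fix t assume "t \<in> T"
    then have "c \<le> t" "t - c \<le> len" using T by auto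
    then show "f t \<in> {0..\<lfloor>len / \<mu>\<rfloor>}"
      using mu by (auto simp: f_def intro!: floor_mono divide_right_mono)
  qed
  ultimately have "card T \<le> card {0..\<lfloor>len / \<mu>\<rfloor>}" by (metis card_inj_on_le finite_atLeastAtMost_int)
  also have "card {0..\<lfloor>len / \<mu>\<rfloor>} = nat (\<lfloor>len / \<mu>\<rfloor> + 1)" by simp
  finally have "card T \<le> nat (\<lfloor>len / \<mu>\<rfloor> + 1)" .
  then have "int (card T) \<le> \<lfloor>len / \<mu>\<rfloor> + 1" proof -
    have "0 \<le> \<lfloor>len / \<mu>\<rfloor>" using mu len by simp
    then show ?thesis using \<open>card T \<le> nat (\<lfloor>len / \<mu>\<rfloor> + 1)\<close> by linarith
  qed
  then show ?thesis by linarith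
qed

text \<open>The test vector that reads off, from a configuration, the component along
  \<open>e\<close> of the difference of balls \<open>j\<close> and \<open>k\<close>.\<close>

definition pair_vec :: "nat \<Rightarrow> nat \<Rightarrow> (nat \<Rightarrow> real) \<Rightarrow> nat \<times> nat \<Rightarrow> real" where
  "pair_vec j k e = (\<lambda>(l, i). if l = j then e i else if l = k then - e i else 0)"

lemma ip_pair_vec:
  assumes "finite S" "j \<in> S" "k \<in> S" "j \<noteq> k"
  shows "ip (S \<times> {..<d}) (pair_vec j k e) f = (\<Sum>i<d. e i * (f (j, i) - f (k, i)))"
proof -
  have "ip (S \<times> {..<d}) (pair_vec j k e) f = (\<Sum>l\<in>S. \<Sum>i<d. pair_vec j k e (l, i) * f (l, i))"
    unfolding ip_def sum.cartesian_product by (simp add: split_def)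
  also have "\<dots> = (\<Sum>l\<in>S. 0) + ((\<Sum>i<d. pair_vec j k e (j, i) * f (j, i)) - 0)
      + ((\<Sum>i<d. pair_vec j k e (k, i) * f (k, i)) - 0)"
    by (rule sum_change_two[OF assms]) (simp add: pair_vec_def)
  also have "\<dots> = (\<Sum>i<d. e i * (f (j, i) - f (k, i)))"
    using assms(4) by (simp add: pair_vec_def right_diff_distrib sum_subtractf sum_negf)
  finally show ?thesis .
qed

lemma ip_pair_vec_self:
  assumes "finite S" "j \<in> S" "k \<in> S" "j \<noteq> k"
  shows "ip (S \<times> {..<d}) (pair_vec j k e) (pair_vec j k e) = 2 * (\<Sum>i<d. (e i)\<^sup>2)"
  unfolding ip_pair_vec[OF assms] using assms(4)
  by (simp add: pair_vec_def sum_distrib_left power2_eq_square mult.left_commute)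

lemma centre_dist_triangle: "centre_dist d x j l t \<le> centre_dist d x j k t + centre_dist d x k l t"
  unfolding centre_dist_def
  using L2_set_triangle_ineq[of "\<lambda>i. x j t i - x k t i" "\<lambda>i. x k t i - x l t i" "{..<d}"] by simp

context separated_evolution
begin

text \<open>The moment of inertia about the centre of mass in terms of mutual distances. It turns a
  lower bound on the norm of \<open>pos\<close> into the existence of a distant pair.\<close>

lemma pos_norm_eq:
  assumes "finite S" "S \<noteq> {}"
  shows "2 * real (card S) * ip (S \<times> {..<d}) (pos S t) (pos S t) = (\<Sum>j\<in>S. \<Sum>k\<in>S. (centre_dist d x j k t)\<^sup>2)"
proof -
  define m where "m = real (card S)"
  have m: "m > 0" using assms by (simp add: m_def card_gt_0_iff)
  have one: "(\<Sum>j\<in>S. \<Sum>k\<in>S. (f j - f k)\<^sup>2) = 2 * (m * (\<Sum>k\<in>S. f k * f k) - (\<Sum>k\<in>S. f k) * (\<Sum>k\<in>S. f k))"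
    for f :: "nat \<Rightarrow> real"
  proof -
    have "(\<Sum>j\<in>S. \<Sum>k\<in>S. (f j - f k)\<^sup>2) = (\<Sum>j\<in>S. m * (f j * f j) - 2 * (\<Sum>k\<in>S. f k) * f j + (\<Sum>k\<in>S. f k * f k))"
    proof (rule sum.cong)
      fix j
      have "(\<Sum>k\<in>S. (f j - f k)\<^sup>2) = (\<Sum>k\<in>S. f j * f j - 2 * f j * f k + f k * f k)"
        by (simp add: power2_eq_square algebra_simps)
      also have "\<dots> = m * (f j * f j) - 2 * f j * (\<Sum>k\<in>S. f k) + (\<Sum>k\<in>S. f k * f k)"
        by (simp add: sum.distrib sum_subtractf sum_distrib_left[symmetric] m_def)
      finally show "(\<Sum>k\<in>S. (f j - f k)\<^sup>2) = m * (f j * f j) - 2 * (\<Sum>k\<in>S. f k) * f j + (\<Sum>k\<in>S. f k * f k)"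
        by (simp only: ac_simps)
    qed simp
    also have "\<dots> = m * (\<Sum>k\<in>S. f k * f k) - 2 * (\<Sum>k\<in>S. f k) * (\<Sum>k\<in>S. f k) + m * (\<Sum>k\<in>S. f k * f k)"
      by (simp only: sum.distrib sum_subtractf sum_distrib_left[symmetric] sum_constant m_def)
    finally show ?thesis by simp
  qed
  have "(\<Sum>j\<in>S. \<Sum>k\<in>S. (centre_dist d x j k t)\<^sup>2) = (\<Sum>j\<in>S. \<Sum>k\<in>S. \<Sum>i<d. (x j t i - x k t i)\<^sup>2)"
    by (simp add: centre_dist_sq)
  also have "\<dots> = (\<Sum>i<d. \<Sum>j\<in>S. \<Sum>k\<in>S. (x j t i - x k t i)\<^sup>2)"
    by (subst sum.swap[of _ "{..<d}"]) (subst sum.swap[of _ "{..<d}"], rule refl)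
  also have "\<dots> = (\<Sum>i<d. 2 * (m * (\<Sum>k\<in>S. x k t i * x k t i) - (\<Sum>l\<in>S. x l t i) * (\<Sum>l\<in>S. x l t i)))"
    by (simp only: one)
  also have "\<dots> = 2 * (m * (\<Sum>i<d. \<Sum>k\<in>S. x k t i * x k t i) - (\<Sum>i<d. (\<Sum>l\<in>S. x l t i) * (\<Sum>l\<in>S. x l t i)))"
    by (simp only: sum_distrib_left[symmetric] sum_subtractf)
  also have "(\<Sum>i<d. \<Sum>k\<in>S. x k t i * x k t i) = (\<Sum>k\<in>S. dot d (x k t) (x k t))"
    unfolding dot_def by (rule sum.swap)
  also have "2 * (m * (\<Sum>k\<in>S. dot d (x k t) (x k t)) - (\<Sum>i<d. (\<Sum>l\<in>S. x l t i) * (\<Sum>l\<in>S. x l t i)))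
     = 2 * m * ((\<Sum>k\<in>S. dot d (x k t) (x k t)) - (\<Sum>i<d. (\<Sum>l\<in>S. x l t i) * (\<Sum>l\<in>S. x l t i)) / m)"
    using m by (simp add: field_simps)
  finally show ?thesis unfolding pos_def ip_centred[OF assms] m_def by simp
qed

text \<open>The order \<open>card S powr (- 3 / 2)\<close> of the gap, relative to the norm, is that of an equally spaced
  line of balls.\<close>

lemma gap_split:
  assumes S: "finite S" "S \<noteq> {}" and pos: "0 < ip (S \<times> {..<d}) (pos S t) (pos S t)"
  defines "\<kappa> \<equiv> real (card S) * sqrt (real (card S))"
  obtains A B where "A \<union> B = S" "A \<inter> B = {}" "A \<noteq> {}" "B \<noteq> {}"
    "\<And>j k. j \<in> A \<Longrightarrow> k \<in> B \<Longrightarrow> sqrt (ip (S \<times> {..<d}) (pos S t) (pos S t)) / (2 * \<kappa>) < centre_dist d x j k t"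
proof -
  define q where "q = ip (S \<times> {..<d}) (pos S t) (pos S t)"
  define m where "m = real (card S)"
  define l where "l = sqrt q / (2 * \<kappa>)"
  have m: "m > 0" using S by (simp add: m_def card_gt_0_iff)
  have kap: "\<kappa> = m * sqrt m" by (simp add: assms m_def)
  have l: "0 \<le> l" using pos m by (simp add: l_def kap q_def)
  have ml: "(m * l)\<^sup>2 * (4 * m) = q"
    using m pos by (simp add: l_def kap q_def power_mult_distrib power_divide field_simps)
  \<comment> \<open>If all distances were at most \<open>m * l\<close>, \<open>pos_norm_eq\<close>
    would bound \<open>2 * q\<close> by \<open>m * (m * l)\<^sup>2\<close>, which is
    \<open>q / 4\<close> by \<open>ml\<close>.\<close>
  have "\<exists>j\<in>S. \<exists>k\<in>S. m * l < centre_dist d x j k t"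
  proof (rule ccontr)
    assume "\<not> ?thesis"
    then have "centre_dist d x j k t \<le> m * l" if "j \<in> S" "k \<in> S" for j k
      using that by (meson not_less)
    then have "(centre_dist d x j k t)\<^sup>2 \<le> (m * l)\<^sup>2" if "j \<in> S" "k \<in> S" for j k
      using that by (intro power_mono) (auto simp: centre_dist_def)
    then have "(\<Sum>j\<in>S. \<Sum>k\<in>S. (centre_dist d x j k t)\<^sup>2) \<le> (\<Sum>j\<in>S. \<Sum>k\<in>S. (m * l)\<^sup>2)"
      by (intro sum_mono)
    also have "\<dots> = m * (m * (m * l)\<^sup>2)" by (simp add: m_def)
    finally have "2 * m * q \<le> m * (m * (m * l)\<^sup>2)"
      using pos_norm_eq[OF S, of t] by (simp add: m_def q_def)
    then have "2 * q \<le> m * (m * l)\<^sup>2" using m by simp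
    moreover have "4 * (m * (m * l)\<^sup>2) = q" using ml by (simp only: ac_simps)
    ultimately show False using pos by (simp add: q_def)
  qed
  then obtain j k where jk: "j \<in> S" "k \<in> S" "real (card S) * l < centre_dist d x j k t" by (auto simp: m_def)
  have "\<exists>A B. A \<union> B = S \<and> A \<inter> B = {} \<and> A \<noteq> {} \<and> B \<noteq> {} \<and>
      (\<forall>a\<in>A. \<forall>b\<in>B. l < centre_dist d x a b t)"
    by (rule cluster_split[where D = "\<lambda>j k. centre_dist d x j k t", OF S(1) jk(1,2) l _ _ jk(3)])
       (rule centre_dist_triangle | simp add: centre_dist_def L2_set_def)+
  then show thesis using that unfolding l_def q_def by blast
qed

text \<open>The component along \<open>w\<close> of the configuration scaled to norm 1. Motion on
  the unit sphere is measured by testing against all \<open>w\<close>.\<close>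

definition shape :: "nat set \<Rightarrow> (nat \<times> nat \<Rightarrow> real) \<Rightarrow> real \<Rightarrow> real" where
  "shape S w t = ip (S \<times> {..<d}) w (pos S t) / sqrt (ip (S \<times> {..<d}) (pos S t) (pos S t))"

text \<open>At time \<open>c\<close> the groups of \<open>gap_split\<close> are more than
  \<open>1 / (2 * \<kappa>)\<close> apart, relative to the norm. The test vector along the direction
  between two balls has norm at most 2, so turning costs at most \<open>1 / (4 * \<kappa>)\<close>.
  What remains, times a norm of at least \<open>8 * \<kappa>\<close>, exceeds the contact distance
  2.\<close>

lemma window_split:
  assumes S: "finite S" "S \<noteq> {}"
  defines "\<kappa> \<equiv> real (card S) * sqrt (real (card S))"
  assumes ce: "c \<le> e"
    and large: "\<And>s. s \<in> {c..e} \<Longrightarrow> (8 * \<kappa>)\<^sup>2 \<le> ip (S \<times> {..<d}) (pos S s) (pos S s)"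
    and turning: "\<And>w s. s \<in> {c..e} \<Longrightarrow>
       \<bar>shape S w s - shape S w c\<bar> \<le> sqrt (ip (S \<times> {..<d}) w w) * (1 / (8 * \<kappa>))"
  obtains A B where "A \<union> B = S" "A \<inter> B = {}" "A \<noteq> {}" "B \<noteq> {}"
    "\<And>j k s. j \<in> A \<Longrightarrow> k \<in> B \<Longrightarrow> s \<in> {c..e} \<Longrightarrow> 2 < centre_dist d x j k s"
proof -
  let ?I = "S \<times> {..<d}"
  define \<rho> where "\<rho> s = sqrt (ip ?I (pos S s) (pos S s))" for s
  have kap: "0 < \<kappa>" using S by (simp add: \<kappa>_def card_gt_0_iff)
  have rho: "8 * \<kappa> \<le> \<rho> s" if "s \<in> {c..e}" for s
    unfolding \<rho>_def using large[OF that] kap by (intro real_le_rsqrt)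
  have "0 < \<rho> c" using rho[of c] ce kap by force
  then have "0 < ip ?I (pos S c) (pos S c)" by (simp add: \<rho>_def)
  from gap_split[OF S this] obtain A B where AB: "A \<union> B = S" "A \<inter> B = {}" "A \<noteq> {}" "B \<noteq> {}"
    "\<And>j k. j \<in> A \<Longrightarrow> k \<in> B \<Longrightarrow> \<rho> c / (2 * \<kappa>) < centre_dist d x j k c"
    unfolding \<rho>_def \<kappa>_def by blast
  show thesis
  proof (rule that[OF AB(1-4)])
    fix j k s assume j: "j \<in> A" and k: "k \<in> B" and s: "s \<in> {c..e}"
    have jk: "j \<in> S" "k \<in> S" "j \<noteq> k" using AB j k by auto
    define y where "y t i = x j t i - x k t i" for t i
    define D where "D = centre_dist d x j k c"
    have D: "\<rho> c / (2 * \<kappa>) < D" using AB(5)[OF j k] by (simp add: D_def)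
    then have D0: "0 < D" using \<open>0 < \<rho> c\<close> kap by (smt (verit) divide_pos_pos)
    define w where "w = pair_vec j k (\<lambda>i. y c i / D)"
    have yy: "(\<Sum>i<d. y t i * y t i) = (centre_dist d x j k t)\<^sup>2" for t
      unfolding centre_dist_sq y_def by (simp add: power2_eq_square)
    have wp: "ip ?I w (pos S t) = (\<Sum>i<d. y c i / D * y t i)" for t
      unfolding w_def ip_pair_vec[OF S(1) jk] by (simp add: pos_def centred_def y_def)
    have ee: "(\<Sum>i<d. (y c i / D)\<^sup>2) = 1"
      using yy[of c] D0 by (simp add: power_divide sum_divide_distrib[symmetric] power2_eq_square D_def)
    have ww: "ip ?I w w = 2"
      unfolding w_def ip_pair_vec_self[OF S(1) jk] ee by simp
    have "ip ?I w (pos S c) = D"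
      unfolding wp using yy[of c] D0 by (simp add: sum_divide_distrib[symmetric] D_def power2_eq_square)
    then have "1 / (2 * \<kappa>) < shape S w c"
      using D \<open>0 < \<rho> c\<close> kap unfolding shape_def \<rho>_def[symmetric] by (simp add: field_simps)
    moreover have "\<bar>shape S w s - shape S w c\<bar> \<le> 2 * (1 / (8 * \<kappa>))"
    proof -
      have "sqrt (ip ?I w w) \<le> 2" unfolding ww by (rule real_le_lsqrt) auto
      then have "sqrt (ip ?I w w) * (1 / (8 * \<kappa>)) \<le> 2 * (1 / (8 * \<kappa>))"
        using kap by (intro mult_right_mono) auto
      then show ?thesis using turning[OF s, of w] by linarith
    qed
    moreover have "1 / (2 * \<kappa>) = 1 / (4 * \<kappa>) + 2 * (1 / (8 * \<kappa>))" by simp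
    ultimately have "1 / (4 * \<kappa>) < shape S w s" by linarith
    then have "1 / (4 * \<kappa>) * \<rho> s < ip ?I w (pos S s)"
      using rho[OF s] kap unfolding shape_def \<rho>_def[symmetric] by (subst (asm) less_divide_eq) auto
    moreover have "2 \<le> 1 / (4 * \<kappa>) * \<rho> s" using rho[OF s] kap by (simp add: field_simps)
    moreover have "ip ?I w (pos S s) \<le> centre_dist d x j k s"
    proof -
      have "(ip ?I w (pos S s))\<^sup>2 = (ip {..<d} (\<lambda>i. y c i / D) (y s))\<^sup>2" by (simp only: wp) (simp only: ip_def)
      also have "\<dots> \<le> ip {..<d} (\<lambda>i. y c i / D) (\<lambda>i. y c i / D) * ip {..<d} (y s) (y s)"
        by (rule ip_Cauchy_Schwarz)
      also have "\<dots> = (centre_dist d x j k s)\<^sup>2"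
        using ee yy[of s] unfolding ip_def by (simp add: power2_eq_square)
      finally show ?thesis by (rule power2_le_imp_le) (simp add: centre_dist_def)
    qed
    ultimately show "2 < centre_dist d x j k s" by linarith
  qed
qed

end

section \<open>Counting\<close>

context separated_evolution
begin

definition events :: "nat set \<Rightarrow> real set \<Rightarrow> (nat \<times> nat \<times> real) set" where
  "events S J = {(j, k, t). j \<in> S \<and> k \<in> S \<and> j < k \<and> t \<in> J \<and> collide d x j k t}"

lemma finite_events:
  assumes "isolated S a b" "J \<subseteq> {a..b}" shows "finite (events S J)"
proof (rule finite_subset)
  show "events S J \<subseteq> S \<times> S \<times> inner_times S a b"
    using assms(2) by (auto simp: events_def inner_times_def)
  show "finite (S \<times> S \<times> inner_times S a b)"
    using isolatedD(1)[OF assms(1)] finite_inner_times[OF assms(1)] by simp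
qed

lemma event_time_unique:
  assumes "isolated S a b" "(j, k, t) \<in> events S J" "(p, q, t) \<in> events S J"
  shows "(j, k) = (p, q)"
proof (rule ccontr)
  assume ne: "(j, k) \<noteq> (p, q)"
  have h: "j \<in> S" "k \<in> S" "p \<in> S" "q \<in> S" "j < k" "p < q" "collide d x j k t" "collide d x p q t"
    using assms by (auto simp: events_def)
  note S = isolatedD(3)[OF assms(1)]
  have "{p, q} \<noteq> {j, k}" using ne h(5,6) by (auto simp: doubleton_eq_iff)
  then have "\<delta> < ball_dist d x p q t" using h by (intro sep[OF h(7)] S) auto
  then show False using h(8) delta_pos by (simp add: ball_dist_def collide_def in_contact_def)
qed

text \<open>Each collision time carries one event, and by \<open>collision_time_gap\<close> these
  times are at least \<open>\<delta> / (2 * r)\<close> apart.\<close>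

lemma events_slow_phase:
  assumes iso: "isolated S a b" and r: "0 < r" and len: "0 \<le> len"
    and E: "\<And>t. t \<in> {a..b} \<Longrightarrow> ip (S \<times> {..<d}) (vel S t) (vel S t) = r\<^sup>2"
    and J: "J \<subseteq> {a..b}" "J \<subseteq> {c..c + len}"
  shows "real (card (events S J)) \<le> 2 * r * len / \<delta> + 1"
proof -
  define T where "T = (\<lambda>(j, k, t). t) ` events S J"
  have "inj_on (\<lambda>(j, k, t). t) (events S J)"
    by (rule inj_onI) (use event_time_unique[OF iso] in auto)
  then have "card (events S J) = card T" by (simp add: T_def card_image)
  also have "real \<dots> \<le> len / (\<delta> / (2 * r)) + 1"
  proof (rule separated_card)
    show "T \<subseteq> {c..c + len}" using J by (auto simp: T_def events_def)
    show "\<delta> / (2 * r) \<le> t - s" if st: "s \<in> T" "t \<in> T" "s < t" for s t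
    proof -
      obtain j k where "(j, k, s) \<in> events S J" using st(1) by (auto simp: T_def)
      moreover obtain p q where "(p, q, t) \<in> events S J" using st(2) by (auto simp: T_def)
      ultimately have "\<delta> \<le> 2 * r * (t - s)"
        using J st r by (intro collision_time_gap[OF iso _ E, of j k s p q t]) (auto simp: events_def)
      then show ?thesis using r by (simp add: field_simps)
    qed
  qed (use r len delta_pos in auto)
  finally show ?thesis by (simp add: mult.commute mult.left_commute)
qed

text \<open>The function \<open>\<theta>\<close> will be \<open>turn\<close> of the time elapsed since, or remaining until, the moment when
  the configuration is smallest; hence the monotonicity condition covers both directions.\<close>

lemma events_fast_phase:
  assumes iso: "isolated S a b"
  defines "\<kappa> \<equiv> real (card S) * sqrt (real (card S))"
  assumes J: "J \<subseteq> {a..b}" "\<And>c e t. c \<in> J \<Longrightarrow> e \<in> J \<Longrightarrow> c \<le> t \<Longrightarrow> t \<le> e \<Longrightarrow> t \<in> J"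
    and large: "\<And>s. s \<in> J \<Longrightarrow> (8 * \<kappa>)\<^sup>2 \<le> ip (S \<times> {..<d}) (pos S s) (pos S s)"
    and turning: "\<And>w s t. s \<in> J \<Longrightarrow> t \<in> J \<Longrightarrow> s \<le> t \<Longrightarrow>
       \<bar>shape S w t - shape S w s\<bar> \<le> sqrt (ip (S \<times> {..<d}) w w) * \<bar>\<theta> t - \<theta> s\<bar>"
    and th_range: "\<And>t. t \<in> J \<Longrightarrow> 0 \<le> \<theta> t \<and> \<theta> t \<le> 2"
    and th_mono: "\<And>c t e. c \<in> J \<Longrightarrow> e \<in> J \<Longrightarrow> c \<le> t \<Longrightarrow> t \<le> e \<Longrightarrow> \<bar>\<theta> t - \<theta> c\<bar> \<le> \<bar>\<theta> e - \<theta> c\<bar>"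
    and IH: "\<And>A c e. isolated A c e \<Longrightarrow> A \<subset> S \<Longrightarrow> real (card (events A {c..e})) \<le> K"
    and K: "0 \<le> K"
  shows "real (card (events S J)) \<le> (16 * \<kappa> + 1) * (2 * K)"
proof -
  note S = isolatedD[OF iso]
  have kap: "0 < \<kappa>" using S(1,2) by (simp add: \<kappa>_def card_gt_0_iff)
  \<comment> \<open>The windows are the level sets of the floor of
    \<open>8 * \<kappa> * \<theta> t\<close>. Since \<open>\<theta>\<close> lies between 0 and 2, at
    most \<open>16 * \<kappa> + 1\<close> of them occur, and inside one \<open>\<theta>\<close>
    varies by at most \<open>1 / (8 * \<kappa>)\<close>, the turning that
    \<open>window_split\<close> tolerates.\<close>
  define cls where "cls q = events S {t \<in> J. \<lfloor>8 * \<kappa> * \<theta> t\<rfloor> = q}" for q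
  define Q where "Q = {0..\<lfloor>16 * \<kappa>\<rfloor>}"
  have fin: "finite (events S J)" by (rule finite_events[OF iso J(1)])
  have cls_sub: "cls q \<subseteq> events S J" for q by (auto simp: cls_def events_def)
  have one: "real (card (cls q)) \<le> 2 * K" for q
  proof (cases "cls q = {}")
    case False
    define T where "T = (\<lambda>(j, k, t). t) ` cls q"
    have T: "finite T" "T \<noteq> {}" using False finite_subset[OF cls_sub fin] by (auto simp: T_def)
    \<comment> \<open>The window is replaced by the span of its collision times, a closed interval
      to which \<open>window_split\<close> and \<open>IH\<close> apply. By \<open>th_mono\<close>
      the turning at intermediate times is controlled by that at the end.\<close>
    define c e where "c = Min T" and "e = Max T"
    have "c \<in> T" "e \<in> T" using T by (auto simp: c_def e_def)
    then have ce: "c \<in> J" "e \<in> J" "\<lfloor>8 * \<kappa> * \<theta> c\<rfloor> = q" "\<lfloor>8 * \<kappa> * \<theta> e\<rfloor> = q"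
      by (auto simp: T_def cls_def events_def)
    have "c \<le> e" using \<open>c \<in> T\<close> T by (simp add: e_def)
    have sub: "cls q \<subseteq> events S {c..e}"
    proof
      fix z assume z: "z \<in> cls q"
      obtain j k t where zt: "z = (j, k, t)" by (cases z)
      have "t \<in> T" using z zt by (force simp: T_def)
      then have "t \<in> {c..e}" using T by (simp add: c_def e_def)
      then show "z \<in> events S {c..e}" using z zt by (auto simp: cls_def events_def)
    qed
    have small: "\<bar>\<theta> e - \<theta> c\<bar> \<le> 1 / (8 * \<kappa>)"
    proof -
      have "\<bar>8 * \<kappa> * \<theta> e - 8 * \<kappa> * \<theta> c\<bar> \<le> 1" using ce(3,4) by linarith
      then have "8 * \<kappa> * \<bar>\<theta> e - \<theta> c\<bar> \<le> 1"
        using kap by (simp add: right_diff_distrib[symmetric] abs_mult)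
      then show ?thesis using kap by (simp add: field_simps)
    qed
    have inJ: "s \<in> J" if "s \<in> {c..e}" for s using J(2)[OF ce(1,2)] that by auto
    obtain A B where AB: "A \<union> B = S" "A \<inter> B = {}" "A \<noteq> {}" "B \<noteq> {}"
      "\<And>j k s. j \<in> A \<Longrightarrow> k \<in> B \<Longrightarrow> s \<in> {c..e} \<Longrightarrow> 2 < centre_dist d x j k s"
    proof (rule window_split[OF S(1,2) \<open>c \<le> e\<close>, folded \<kappa>_def])
      show "(8 * \<kappa>)\<^sup>2 \<le> ip (S \<times> {..<d}) (pos S s) (pos S s)" if "s \<in> {c..e}" for s
        by (rule large[OF inJ[OF that]])
      show "\<bar>shape S w s - shape S w c\<bar> \<le> sqrt (ip (S \<times> {..<d}) w w) * (1 / (8 * \<kappa>))"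
        if s: "s \<in> {c..e}" for w s
      proof -
        have "\<bar>\<theta> s - \<theta> c\<bar> \<le> 1 / (8 * \<kappa>)" using th_mono[OF ce(1,2), of s] s small by simp
        then have "sqrt (ip (S \<times> {..<d}) w w) * \<bar>\<theta> s - \<theta> c\<bar> \<le> sqrt (ip (S \<times> {..<d}) w w) * (1 / (8 * \<kappa>))"
          by (intro mult_left_mono) (simp_all add: ip_self_nonneg)
        then show ?thesis using turning[OF ce(1) inJ[OF s], of w] s by simp
      qed
    qed blast
    \<comment> \<open>The two groups never touch during the window, so each is isolated in its own
      right and every event lies within one of them. This gives \<open>2 * K\<close>.\<close>
    have no: "\<not> collide d x j k s" "\<not> collide d x k j s" if "j \<in> A" "k \<in> B" "s \<in> {c..e}" for j k s
      using AB(5)[OF that] centre_dist_commute[of d x j k s] by (auto simp: collide_def in_contact_def)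
    have iso': "isolated S c e" by (rule isolated_subinterval[OF iso]) (use J(1) ce in auto)
    have isoA: "isolated A c e" and isoB: "isolated B c e"
      using iso' AB(1-4) no unfolding isolated_def by blast+
    have "events S {c..e} \<subseteq> events A {c..e} \<union> events B {c..e}"
      using AB(1) no by (auto simp: events_def)
    then have "cls q \<subseteq> events A {c..e} \<union> events B {c..e}" using sub by blast
    then have "card (cls q) \<le> card (events A {c..e} \<union> events B {c..e})"
      by (rule card_mono[rotated]) (simp add: finite_events[OF isoA] finite_events[OF isoB])
    also have "\<dots> \<le> card (events A {c..e}) + card (events B {c..e})" by (rule card_Un_le)
    finally have "real (card (cls q)) \<le> real (card (events A {c..e})) + real (card (events B {c..e}))"
      by linarith
    moreover have "A \<subset> S" "B \<subset> S" using AB(1-4) by auto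
    ultimately show ?thesis using IH[OF isoA] IH[OF isoB] by linarith
  qed (use K in simp)
  have "events S J \<subseteq> (\<Union>q\<in>Q. cls q)"
  proof
    fix z assume z: "z \<in> events S J"
    obtain j k t where zt: "z = (j, k, t)" by (cases z)
    then have t: "t \<in> J" using z by (simp add: events_def)
    have "0 \<le> 8 * \<kappa> * \<theta> t" using th_range[OF t] kap by simp
    moreover have "8 * \<kappa> * \<theta> t \<le> 8 * \<kappa> * 2" using th_range[OF t] kap by (intro mult_left_mono) auto
    ultimately have "\<lfloor>8 * \<kappa> * \<theta> t\<rfloor> \<in> Q" unfolding Q_def by (auto intro: floor_mono)
    moreover have "z \<in> cls \<lfloor>8 * \<kappa> * \<theta> t\<rfloor>" using z zt by (auto simp: cls_def events_def)
    ultimately show "z \<in> (\<Union>q\<in>Q. cls q)" by blast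
  qed
  then have "card (events S J) \<le> card (\<Union>q\<in>Q. cls q)"
    by (rule card_mono[rotated]) (use finite_subset[OF cls_sub fin] in \<open>auto simp: Q_def\<close>)
  also have "\<dots> \<le> (\<Sum>q\<in>Q. card (cls q))" by (rule card_UN_le) (simp add: Q_def)
  finally have "real (card (events S J)) \<le> (\<Sum>q\<in>Q. real (card (cls q)))"
    by (metis of_nat_le_iff of_nat_sum)
  also have "\<dots> \<le> (\<Sum>q\<in>Q. 2 * K)" by (intro sum_mono one)
  also have "\<dots> = real (card Q) * (2 * K)" by simp
  also have "\<dots> \<le> (16 * \<kappa> + 1) * (2 * K)"
  proof (rule mult_right_mono)
    have "0 \<le> \<lfloor>16 * \<kappa>\<rfloor>" using kap by simp
    then have "real (card Q) = real_of_int (\<lfloor>16 * \<kappa>\<rfloor> + 1)" by (simp add: Q_def)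
    then show "real (card Q) \<le> 16 * \<kappa> + 1" by linarith
  qed (use K in simp)
  finally show ?thesis .
qed

section \<open>Growth and turning in both time directions\<close>

lemma
  assumes iso: "isolated S a b" and r: "0 < r" and R: "0 < R" and t0: "t0 \<in> {a..b}"
    and E: "\<And>t. t \<in> {a..b} \<Longrightarrow> ip (S \<times> {..<d}) (vel S t) (vel S t) = r\<^sup>2"
    and E': "\<And>t. t \<in> {a..b} \<Longrightarrow> ip (S \<times> {..<d}) (vel_pre S t) (vel_pre S t) = r\<^sup>2"
    and R2: "ip (S \<times> {..<d}) (pos S t0) (pos S t0) = R\<^sup>2"
    and mini: "\<And>t. t \<in> {a..b} \<Longrightarrow> R\<^sup>2 \<le> ip (S \<times> {..<d}) (pos S t) (pos S t)"
  shows forward_growth: "\<And>t. t0 \<le> t \<Longrightarrow> t \<le> b \<Longrightarrow>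
      R\<^sup>2 + (r * (t - t0))\<^sup>2 \<le> ip (S \<times> {..<d}) (pos S t) (pos S t)"
    and forward_turning: "\<And>s t w. t0 \<le> s \<Longrightarrow> s \<le> t \<Longrightarrow> t \<le> b \<Longrightarrow>
      \<bar>shape S w t - shape S w s\<bar> \<le> sqrt (ip (S \<times> {..<d}) w w) * (turn R r (t - t0) - turn R r (s - t0))"
    and backward_growth: "\<And>t. a \<le> t \<Longrightarrow> t \<le> t0 \<Longrightarrow>
      R\<^sup>2 + (r * (t0 - t))\<^sup>2 \<le> ip (S \<times> {..<d}) (pos S t) (pos S t)"
    and backward_turning: "\<And>s t w. a \<le> s \<Longrightarrow> s \<le> t \<Longrightarrow> t \<le> t0 \<Longrightarrow>
      \<bar>shape S w t - shape S w s\<bar> \<le> sqrt (ip (S \<times> {..<d}) w w) * (turn R r (t0 - s) - turn R r (t0 - t))"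
proof -
  let ?I = "S \<times> {..<d}"
  let ?C = "inner_times S a b"
  note C = finite_inner_times[OF iso]
  have lin: "pos S s i = pos S a' i + (s - a') * vel S a' i"
    if "t0 \<le> a'" "a' < b'" "b' \<le> b" "?C \<inter> {a'<..<b'} = {}" "s \<in> {a'..b'}" "i \<in> ?I" for a' b' s i
    by (rule pos_line[OF iso _ that(2-6)]) (use that t0 in auto)
  have jump: "ip ?I (pos S b') (vel S a') \<le> ip ?I (pos S b') (vel S b')"
    if "t0 \<le> a'" "a' < b'" "b' \<le> b" "?C \<inter> {a'<..<b'} = {}" for a' b'
  proof -
    have "ip ?I (pos S b') (vel S a') = ip ?I (pos S b') (vel_pre S b')"
      by (rule ip_cong[OF refl vel_pre_eq[OF iso _ that(2-4), symmetric]]) (use that t0 in auto)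
    also have "\<dots> \<le> ip ?I (pos S b') (vel S b')" by (rule radial_jump[OF iso]) (use that t0 in auto)
    finally show ?thesis .
  qed
  show "R\<^sup>2 + (r * (t - t0))\<^sup>2 \<le> ip ?I (pos S t) (pos S t)" if "t0 \<le> t" "t \<le> b" for t
    by (rule growth_from_minimum[OF C R r lin jump E R2 _ that]) (use t0 mini R2 in auto)
  show "\<bar>shape S w t - shape S w s\<bar> \<le> sqrt (ip ?I w w) * (turn R r (t - t0) - turn R r (s - t0))"
    if "t0 \<le> s" "s \<le> t" "t \<le> b" for s t w
    unfolding shape_def
    by (rule turning_from_minimum[OF C R r lin jump E R2 _ that]) (use t0 mini R2 in auto)
  text \<open>Reversing time exchanges the velocities before and after each collision.\<close>
  define Z where "Z s = pos S (- s)" for s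
  define V where "V s = (\<lambda>i. - vel_pre S (- s) i)" for s
  have C': "finite (uminus ` ?C)" using C by simp
  have free: "?C \<inter> {- b'<..<- a'} = {}" if "uminus ` ?C \<inter> {a'<..<b'} = {}" for a' b'
  proof (rule ccontr)
    assume "?C \<inter> {- b'<..<- a'} \<noteq> {}"
    then obtain u where "u \<in> ?C" "- b' < u" "u < - a'" by auto
    then have "- u \<in> uminus ` ?C \<inter> {a'<..<b'}" by auto
    then show False using that by blast
  qed
  have pre: "vel_pre S (- a') i = vel S (- b') i"
    if "- t0 \<le> a'" "a' < b'" "b' \<le> - a" "uminus ` ?C \<inter> {a'<..<b'} = {}" "i \<in> ?I" for a' b' i
    by (rule vel_pre_eq[OF iso _ _ _ free[OF that(4)] that(5)]) (use that t0 in auto)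
  have lin': "Z s i = Z a' i + (s - a') * V a' i"
    if h: "- t0 \<le> a'" "a' < b'" "b' \<le> - a" "uminus ` ?C \<inter> {a'<..<b'} = {}" "s \<in> {a'..b'}" "i \<in> ?I"
    for a' b' s i
  proof -
    have "pos S u i = pos S (- b') i + (u - - b') * vel S (- b') i" if "u \<in> {- b'..- a'}" for u
      by (rule pos_line[OF iso _ _ _ free[OF h(4)] that h(6)]) (use h t0 in auto)
    from this[of "- s"] this[of "- a'"] show ?thesis
      unfolding Z_def V_def using h pre[OF h(1-4,6)] by (simp add: algebra_simps)
  qed
  have neg: "ip ?I f (\<lambda>i. - g i) = - ip ?I f g" for f g by (simp add: ip_def sum_negf)
  \<comment> \<open>In reversed time a collision changes the velocity from \<open>- vel\<close> to
    \<open>- vel_pre\<close>, so \<open>radial_jump\<close> with both sides negated is again an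
    increase.\<close>
  have jump': "ip ?I (Z b') (V a') \<le> ip ?I (Z b') (V b')"
    if h: "- t0 \<le> a'" "a' < b'" "b' \<le> - a" "uminus ` ?C \<inter> {a'<..<b'} = {}" for a' b'
  proof -
    have "ip ?I (Z b') (V a') = - ip ?I (pos S (- b')) (vel S (- b'))"
      unfolding Z_def V_def neg using pre[OF h] by (simp cong: ip_cong)
    also have "\<dots> \<le> - ip ?I (pos S (- b')) (vel_pre S (- b'))"
      using radial_jump[OF iso, of "- b'"] h t0 by auto
    finally show ?thesis by (simp add: Z_def V_def neg)
  qed
  have en': "ip ?I (V t) (V t) = r\<^sup>2" if "- t0 \<le> t" "t \<le> - a" for t
    using E'[of "- t"] that t0 by (simp add: V_def ip_def)
  have Z0: "ip ?I (Z (- t0)) (Z (- t0)) = R\<^sup>2" using R2 by (simp add: Z_def)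
  have mini': "ip ?I (Z (- t0)) (Z (- t0)) \<le> ip ?I (Z t) (Z t)" if "- t0 \<le> t" "t \<le> - a" for t
    unfolding Z0 using mini[of "- t"] that t0 by (simp add: Z_def)
  show "R\<^sup>2 + (r * (t0 - t))\<^sup>2 \<le> ip ?I (pos S t) (pos S t)" if "a \<le> t" "t \<le> t0" for t
  proof -
    have "R\<^sup>2 + (r * (- t - - t0))\<^sup>2 \<le> ip ?I (Z (- t)) (Z (- t))"
      by (rule growth_from_minimum[OF C' R r lin' jump' en' Z0 mini']) (use that in auto)
    then show ?thesis by (simp add: Z_def)
  qed
  show "\<bar>shape S w t - shape S w s\<bar> \<le> sqrt (ip ?I w w) * (turn R r (t0 - s) - turn R r (t0 - t))"
    if "a \<le> s" "s \<le> t" "t \<le> t0" for s t w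
  proof -
    have "\<bar>ip ?I w (Z (- s)) / sqrt (ip ?I (Z (- s)) (Z (- s))) - ip ?I w (Z (- t)) / sqrt (ip ?I (Z (- t)) (Z (- t)))\<bar>
       \<le> sqrt (ip ?I w w) * (turn R r (- s - - t0) - turn R r (- t - - t0))"
      by (rule turning_from_minimum[OF C' R r lin' jump' en' Z0 mini']) (use that in auto)
    then show ?thesis by (simp add: Z_def shape_def abs_minus_commute)
  qed
qed

lemma pos_norm_continuous: "S \<subseteq> {..<n} \<Longrightarrow> continuous_on A (\<lambda>t. ip (S \<times> {..<d}) (pos S t) (pos S t))"
  unfolding ip_def pos_def centred_def split_def divide_inverse
  by (intro continuous_intros continuous_coordinate) auto

text \<open>Two balls that do not overlap cannot both sit at the centre of mass. This makes the
  minimal norm \<open>R\<close> of \<open>events_step\<close> positive.\<close>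

lemma pos_norm_positive:
  assumes iso: "isolated S a b" and jk: "j \<in> S" "k \<in> S" "j \<noteq> k"
  shows "0 < ip (S \<times> {..<d}) (pos S t) (pos S t)"
proof (rule ccontr)
  assume "\<not> ?thesis"
  then have "ip (S \<times> {..<d}) (pos S t) (pos S t) = 0\<^sup>2"
    using ip_self_nonneg[of "S \<times> {..<d}" "pos S t"] by simp
  then have "centre_dist d x j k t \<le> 2 * 0"
    unfolding centre_dist_pos[of j k t S] by (intro L2_set_diff_le[OF isolatedD(1)[OF iso] jk(1,2)]) auto
  moreover have "2 \<le> centre_dist d x j k t"
    using evol jk isolatedD(3)[OF iso] by (simp add: hard_ball_evolution_def)
  ultimately show False by simp
qed

text \<open>Time is cut around the moment \<open>t0\<close> of smallest norm. Close to
  \<open>t0\<close> collisions are counted by their time gaps. Before and after, growth has made the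
  norm large, and \<open>events_fast_phase\<close> applies with \<open>turn\<close> as
  clock.\<close>

lemma events_step:
  assumes iso: "isolated S a b"
  defines "\<kappa> \<equiv> real (card S) * sqrt (real (card S))"
  assumes IH: "\<And>A c e. isolated A c e \<Longrightarrow> A \<subset> S \<Longrightarrow> real (card (events A {c..e})) \<le> K" and K: "0 \<le> K"
  shows "real (card (events S {a..b})) \<le> 32 * \<kappa> / \<delta> + 1 + 2 * ((16 * \<kappa> + 1) * (2 * K))"
proof (cases "events S {a..b} = {}")
  case True
  have "0 \<le> \<kappa>" by (simp add: \<kappa>_def)
  then show ?thesis using True K delta_pos by simp
next
  case False
  let ?I = "S \<times> {..<d}"
  let ?q = "\<lambda>t. ip ?I (pos S t) (pos S t)"
  note S = isolatedD[OF iso]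
  obtain j k u where ev: "(j, k, u) \<in> events S {a..b}" using False by auto
  then have jk: "j \<in> S" "k \<in> S" "j \<noteq> k" "collide d x j k u" "u \<in> {a..b}" by (auto simp: events_def)
  obtain r where r0: "0 \<le> r" and E: "\<And>t. t \<in> {a..b} \<Longrightarrow> ip ?I (vel S t) (vel S t) = r\<^sup>2"
    and E': "\<And>t. t \<in> {a..b} \<Longrightarrow> ip ?I (vel_pre S t) (vel_pre S t) = r\<^sup>2"
    using energy_constant[OF iso] by blast
  have r: "0 < r" using collision_needs_energy[OF iso jk(5,4,1,2) E'[OF jk(5)]] r0 by simp
  have kap: "0 < \<kappa>" using S(1,2) by (simp add: \<kappa>_def card_gt_0_iff)
  obtain t0 where t0: "t0 \<in> {a..b}" "\<And>t. t \<in> {a..b} \<Longrightarrow> ?q t0 \<le> ?q t"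
  proof -
    have "S \<subseteq> {..<n}" using iso by (simp add: isolated_def)
    from continuous_attains_inf[OF compact_Icc _ pos_norm_continuous[OF this], of a b] jk(5)
    show ?thesis using that by auto
  qed
  define R where "R = sqrt (?q t0)"
  have R: "0 < R" using pos_norm_positive[OF iso jk(1-3)] by (simp add: R_def)
  have R2: "?q t0 = R\<^sup>2" by (simp add: R_def ip_self_nonneg)
  have mini: "R\<^sup>2 \<le> ?q t" if "t \<in> {a..b}" for t using t0(2)[OF that] R2 by simp
  note turning = forward_growth[OF iso r R t0(1) E E' R2 mini] forward_turning[OF iso r R t0(1) E E' R2 mini]
    backward_growth[OF iso r R t0(1) E E' R2 mini] backward_turning[OF iso r R t0(1) E E' R2 mini]
  \<comment> \<open>With \<open>r * T = 8 * \<kappa>\<close>, growth alone gives the norm required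
    by \<open>window_split\<close> at times at least \<open>T\<close> away from \<open>t0\<close>,
    and the middle phase of length \<open>2 * T\<close> contributes
    \<open>32 * \<kappa> / \<delta> + 1\<close>.\<close>
  define T where "T = 8 * \<kappa> / r"
  have T: "0 < T" "r * T = 8 * \<kappa>" using kap r by (simp_all add: T_def)
  \<comment> \<open>The end \<open>t0 - T + 2 * T\<close> has the form \<open>c + len\<close>
    expected by \<open>events_slow_phase\<close>.\<close>
  define M F B where "M = {a..b} \<inter> {t0 - T..t0 - T + 2 * T}"
    and "F = {t0 + T..b}" and "B = {a..t0 - T}"
  have big: "(8 * \<kappa>)\<^sup>2 \<le> q" if "T \<le> h" "R\<^sup>2 + (r * h)\<^sup>2 \<le> q" for h q
  proof -
    have "8 * \<kappa> \<le> r * h" using that(1) r by (simp flip: T(2))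
    then have "(8 * \<kappa>)\<^sup>2 \<le> (r * h)\<^sup>2" using kap by (intro power_mono) auto
    moreover have "0 \<le> R\<^sup>2" by simp
    ultimately show ?thesis using that(2) by linarith
  qed
  have "real (card (events S M)) \<le> 2 * r * (2 * T) / \<delta> + 1"
    by (rule events_slow_phase[OF iso r _ E]) (use T in \<open>auto simp: M_def\<close>)
  also have "2 * r * (2 * T) = 32 * \<kappa>" using T(2) by simp
  finally have cM: "real (card (events S M)) \<le> 32 * \<kappa> / \<delta> + 1" .
  have cF: "real (card (events S F)) \<le> (16 * \<kappa> + 1) * (2 * K)"
  proof (rule events_fast_phase[where \<theta> = "\<lambda>t. turn R r (t - t0)", OF iso _ _ _ _ _ _ IH K, folded \<kappa>_def])
    show "F \<subseteq> {a..b}" using t0 T by (auto simp: F_def)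
    show "(8 * \<kappa>)\<^sup>2 \<le> ?q s" if "s \<in> F" for s
      by (rule big[OF _ turning(1)]) (use that T in \<open>auto simp: F_def\<close>)
    show "0 \<le> turn R r (s - t0) \<and> turn R r (s - t0) \<le> 2" if "s \<in> F" for s
      using turn_bounds[OF R r] that T by (auto simp: F_def)
    show "\<bar>shape S w t - shape S w s\<bar> \<le> sqrt (ip ?I w w) * \<bar>turn R r (t - t0) - turn R r (s - t0)\<bar>"
      if "s \<in> F" "t \<in> F" "s \<le> t" for w s t
      using turning(2)[of s t w] turn_mono[OF R r, of "s - t0" "t - t0"] that T by (auto simp: F_def)
    show "\<bar>turn R r (t - t0) - turn R r (c - t0)\<bar> \<le> \<bar>turn R r (e - t0) - turn R r (c - t0)\<bar>"
      if "c \<in> F" "e \<in> F" "c \<le> t" "t \<le> e" for c t e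
      using turn_mono[OF R r, of "c - t0" "t - t0"] turn_mono[OF R r, of "t - t0" "e - t0"] that T
      by (auto simp: F_def)
  qed (auto simp: F_def)
  have cB: "real (card (events S B)) \<le> (16 * \<kappa> + 1) * (2 * K)"
  proof (rule events_fast_phase[where \<theta> = "\<lambda>t. turn R r (t0 - t)", OF iso _ _ _ _ _ _ IH K, folded \<kappa>_def])
    show "B \<subseteq> {a..b}" using t0 T by (auto simp: B_def)
    show "(8 * \<kappa>)\<^sup>2 \<le> ?q s" if "s \<in> B" for s
      by (rule big[OF _ turning(3)]) (use that T in \<open>auto simp: B_def\<close>)
    show "0 \<le> turn R r (t0 - s) \<and> turn R r (t0 - s) \<le> 2" if "s \<in> B" for s
      using turn_bounds[OF R r] that T by (auto simp: B_def)
    show "\<bar>shape S w t - shape S w s\<bar> \<le> sqrt (ip ?I w w) * \<bar>turn R r (t0 - t) - turn R r (t0 - s)\<bar>"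
      if "s \<in> B" "t \<in> B" "s \<le> t" for w s t
      using turning(4)[of s t w] turn_mono[OF R r, of "t0 - t" "t0 - s"] that T by (auto simp: B_def)
    show "\<bar>turn R r (t0 - t) - turn R r (t0 - c)\<bar> \<le> \<bar>turn R r (t0 - e) - turn R r (t0 - c)\<bar>"
      if "c \<in> B" "e \<in> B" "c \<le> t" "t \<le> e" for c t e
      using turn_mono[OF R r, of "t0 - t" "t0 - c"] turn_mono[OF R r, of "t0 - e" "t0 - t"] that T
      by (auto simp: B_def)
  qed (auto simp: B_def)
  have "events S {a..b} \<subseteq> events S M \<union> (events S F \<union> events S B)"
    by (auto simp: events_def M_def F_def B_def)
  moreover have "finite (events S M \<union> (events S F \<union> events S B))"
    using t0(1) T by (auto intro!: finite_events[OF iso] simp: M_def F_def B_def)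
  ultimately have "card (events S {a..b}) \<le> card (events S M \<union> (events S F \<union> events S B))"
    by (rule card_mono[rotated])
  also have "\<dots> \<le> card (events S M) + (card (events S F) + card (events S B))"
    using card_Un_le[of "events S M" "events S F \<union> events S B"] card_Un_le[of "events S F" "events S B"]
    by linarith
  finally have "real (card (events S {a..b}))
      \<le> real (card (events S M)) + (real (card (events S F)) + real (card (events S B)))"
    by linarith
  then show ?thesis using cM cF cB by linarith
qed

text \<open>With \<open>card S\<close> in the coefficients replaced by \<open>n\<close>, the
  recursion reads \<open>K m \<le> M + N * K (m - 1)\<close>, and \<open>M * m * N ^ m\<close>
  satisfies it because \<open>N\<close> is at least 1.\<close>

lemma events_bound:
  defines "\<kappa> \<equiv> real n * sqrt (real n)"
  defines "M \<equiv> 32 * \<kappa> / \<delta> + 1" and "N \<equiv> 4 * (16 * \<kappa> + 1)"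
  assumes "isolated S a b"
  shows "real (card (events S {a..b})) \<le> M * real (card S) * N ^ card S"
  using assms(4)
proof (induction "card S" arbitrary: S a b rule: less_induct)
  case less
  note iso = less.prems
  note S = isolatedD[OF iso]
  have kap: "0 \<le> \<kappa>" by (simp add: \<kappa>_def)
  have M: "1 \<le> M" using kap delta_pos by (simp add: M_def)
  have N: "1 \<le> N" using kap by (simp add: N_def)
  define c where "c = card S - 1"
  have c: "card S = Suc c" using S(1,2) by (simp add: c_def card_gt_0_iff)
  define K where "K = M * real c * N ^ c"
  have K: "0 \<le> K" using M N by (simp add: K_def)
  have "card S \<le> n" using iso card_mono[of "{..<n}" S] by (simp add: isolated_def)
  then have kS: "real (card S) * sqrt (real (card S)) \<le> \<kappa>"
    unfolding \<kappa>_def by (intro mult_mono) auto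
  have IH: "real (card (events A {c'..e})) \<le> K" if A: "isolated A c' e" "A \<subset> S" for A c' e
  proof -
    have lt: "card A < card S" using A(2) S(1) by (simp add: psubset_card_mono)
    then have "real (card (events A {c'..e})) \<le> M * real (card A) * N ^ card A"
      using less.hyps[OF _ A(1)] by simp
    also have "\<dots> \<le> K" unfolding K_def
      using lt c M N by (intro mult_mono power_increasing) auto
    finally show ?thesis .
  qed
  have "real (card (events S {a..b})) \<le> 32 * (real (card S) * sqrt (real (card S))) / \<delta> + 1
      + 2 * ((16 * (real (card S) * sqrt (real (card S))) + 1) * (2 * K))"
    by (rule events_step[OF iso IH K])
  also have "\<dots> \<le> M + 2 * ((16 * \<kappa> + 1) * (2 * K))"
    unfolding M_def using kS K delta_pos
    by (intro add_mono mult_left_mono mult_right_mono divide_right_mono) auto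
  also have "\<dots> = M + N * K" by (simp add: N_def)
  also have "\<dots> = M * (1 + real c * N ^ Suc c)" by (simp add: K_def algebra_simps)
  also have "\<dots> \<le> M * (N ^ Suc c + real c * N ^ Suc c)"
    using M N by (intro mult_left_mono add_right_mono one_le_power) auto
  also have "\<dots> = M * real (card S) * N ^ card S" by (simp add: c algebra_simps)
  finally show ?case .
qed

text \<open>Finitely many collisions fit into a bounded time interval, on which the whole system is
  isolated, and \<open>events_bound\<close> does not depend on the length of this interval. A
  uniform bound on finite subsets then yields finiteness.\<close>

lemma collisions_bound:
  assumes "0 < n"
  defines "\<kappa> \<equiv> real n * sqrt (real n)"
  shows "finite (collisions n d x) \<and>
    real (card (collisions n d x)) \<le> (32 * \<kappa> / \<delta> + 1) * real n * (4 * (16 * \<kappa> + 1)) ^ n"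
proof -
  define L where "L = (32 * \<kappa> / \<delta> + 1) * real n * (4 * (16 * \<kappa> + 1)) ^ n"
  have fin: "real (card X) \<le> L" if X: "X \<subseteq> collisions n d x" "finite X" for X
  proof -
    define T where "T = Max (insert 0 ((\<lambda>(j, k, t). \<bar>t\<bar>) ` X))"
    have T: "\<bar>t\<bar> \<le> T" if "(j, k, t) \<in> X" for j k t
      unfolding T_def using X(2) that by (intro Max_ge) force+
    have iso: "isolated {..<n} (- T) T" using assms(1) by (auto simp: isolated_def)
    have "X \<subseteq> events {..<n} {- T..T}"
    proof
      fix z assume z: "z \<in> X"
      obtain j k t where zt: "z = (j, k, t)" by (cases z)
      have "\<bar>t\<bar> \<le> T" using T z zt by blast
      then show "z \<in> events {..<n} {- T..T}"
        using z zt X(1) by (auto simp: events_def collisions_def abs_le_iff)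
    qed
    then have "card X \<le> card (events {..<n} {- T..T})"
      by (rule card_mono[OF finite_events[OF iso order_refl]])
    then show ?thesis using events_bound[OF iso] by (simp add: L_def \<kappa>_def)
  qed
  have "finite (collisions n d x)"
  proof (rule ccontr)
    assume "infinite (collisions n d x)"
    then obtain X where "X \<subseteq> collisions n d x" "finite X" "card X = Suc (nat \<lfloor>L\<rfloor>)"
      by (meson infinite_arbitrarily_large)
    then have "real (Suc (nat \<lfloor>L\<rfloor>)) \<le> L" using fin by metis
    then show False by linarith
  qed
  then show ?thesis using fin[OF order_refl] by (simp add: L_def)
qed

end

section \<open>Asymptotics of the bound\<close>

text \<open>The constant is \<open>17952 = 33 * 8 * 68\<close>: 33 comes from \<open>32 + 1\<close>,
  68 from \<open>4 * (16 + 1)\<close>, and 8 absorbs the polynomial factor, as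
  \<open>\<kappa> * n\<close> is at most the cube of \<open>n\<close> and hence at most
  \<open>8 ^ n\<close>. The threshold makes \<open>17952 ^ n\<close> at most \<open>n\<close> to the
  power \<open>\<epsilon> * n\<close>. What is left, \<open>n ^ n * \<kappa> ^ n\<close>, is
  \<open>n\<close> to the power \<open>5 * n / 2\<close>.\<close>

lemma bound_asymptotics:
  assumes eps: "0 < \<epsilon>" and n1: "1 \<le> n" and n: "17952 powr (1 / \<epsilon>) \<le> real n"
  defines "\<kappa> \<equiv> real n * sqrt (real n)"
  shows "(32 * \<kappa> / real n powr (- real n) + 1) * real n * (4 * (16 * \<kappa> + 1)) ^ n
    \<le> real n powr (5 * real n / 2 + \<epsilon> * real n)"
proof -
  define y where "y = real n"
  have y: "1 \<le> y" using n1 by (simp add: y_def)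
  have kap: "\<kappa> = y powr (3 / 2)"
    using y powr_add[of y 1 "1 / 2"] by (simp add: \<kappa>_def y_def powr_half_sqrt)
  have kap1: "1 \<le> \<kappa>" unfolding kap using y by (simp add: ge_one_powr_ge_zero)
  have "17952 = (17952 powr (1 / \<epsilon>)) powr \<epsilon>" using eps by (simp add: powr_powr)
  also have "\<dots> \<le> y powr \<epsilon>" unfolding y_def using eps n by (intro powr_mono2) auto
  finally have big: "17952 \<le> y powr \<epsilon>" .
  have yn: "1 \<le> y powr y" using y by (simp add: ge_one_powr_ge_zero)
  have "32 * \<kappa> / y powr (- y) + 1 \<le> 33 * (\<kappa> * y powr y)"
  proof -
    have "32 * \<kappa> / y powr (- y) = 32 * (\<kappa> * y powr y)" by (simp add: powr_minus field_simps)
    moreover have "1 * 1 \<le> \<kappa> * y powr y" using kap1 yn by (intro mult_mono) auto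
    ultimately show ?thesis by linarith
  qed
  moreover have "(4 * (16 * \<kappa> + 1)) ^ n \<le> (68 * \<kappa>) ^ n"
    using kap1 by (intro power_mono) auto
  ultimately have "(32 * \<kappa> / y powr (- y) + 1) * y * (4 * (16 * \<kappa> + 1)) ^ n
     \<le> (33 * (\<kappa> * y powr y)) * y * (68 * \<kappa>) ^ n"
    using kap1 y by (intro mult_mono) auto
  also have "\<dots> = 33 * (\<kappa> * y) * 68 ^ n * (y powr y * \<kappa> ^ n)"
    by (simp add: power_mult_distrib ac_simps)
  also have "\<dots> \<le> 17952 ^ n * (y powr y * \<kappa> ^ n)"
  proof (rule mult_right_mono)
    have "\<kappa> \<le> y * y" unfolding kap using y powr_mono[of "3/2" 2 y] by (simp add: power2_eq_square)
    then have "\<kappa> * y \<le> y * y * y" using y by (intro mult_right_mono) auto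
    also have "y * y * y \<le> 2 ^ n * 2 ^ n * 2 ^ n"
    proof -
      have "y \<le> 2 ^ n" unfolding y_def using less_exp[of n] by (metis less_imp_le of_nat_le_iff of_nat_numeral of_nat_power)
      then show ?thesis using y by (intro mult_mono) auto
    qed
    also have "(2::real) ^ n * 2 ^ n * 2 ^ n = 8 ^ n" by (simp flip: power_mult_distrib)
    finally have "\<kappa> * y \<le> 8 ^ n" .
    moreover have "(33::real) \<le> 33 ^ n" using n1 power_increasing[of 1 n "33::real"] by simp
    ultimately have "33 * (\<kappa> * y) * 68 ^ n \<le> 33 ^ n * 8 ^ n * 68 ^ n"
      using kap1 y by (intro mult_mono) auto
    also have "\<dots> = 17952 ^ n" by (simp flip: power_mult_distrib)
    finally show "33 * (\<kappa> * y) * 68 ^ n \<le> 17952 ^ n" .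
  qed (use kap1 in simp)
  also have "\<dots> \<le> (y powr \<epsilon>) ^ n * (y powr y * \<kappa> ^ n)"
    using big kap1 by (intro mult_right_mono power_mono) auto
  also have "\<dots> = y powr (5 * y / 2 + \<epsilon> * y)"
  proof -
    have "(y powr \<epsilon>) ^ n = y powr (\<epsilon> * y)" "\<kappa> ^ n = y powr (3 / 2 * y)"
      unfolding kap using y by (simp_all add: powr_powr y_def flip: powr_realpow)
    then show ?thesis by (simp add: powr_add[symmetric] algebra_simps)
  qed
  finally show ?thesis by (simp add: y_def)
qed

theorem theorem1p2:
  "\<forall>\<epsilon>::real. \<epsilon> > 0 \<longrightarrow>
    (\<exists>n0::nat. \<forall>n\<ge>n0. \<forall>d::nat. d \<ge> 2 \<longrightarrow>
      (\<forall>x. hard_ball_evolution n d x \<longrightarrow>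
           no_simultaneous_collisions n d x \<longrightarrow>
           (\<forall>(j, k, t)\<in>collisions n d x. \<forall>l<n. \<forall>m<n. l \<noteq> m \<longrightarrow> {l, m} \<noteq> {j, k} \<longrightarrow>
              ball_dist d x l m t > real n powr (- real n)) \<longrightarrow>
           finite (collisions n d x) \<and>
           real (card (collisions n d x)) \<le> real n powr (5 * real n / 2 + \<epsilon> * real n)))"
proof (intro allI impI)
  fix \<epsilon> :: real assume eps: "\<epsilon> > 0"
  show "\<exists>n0::nat. \<forall>n\<ge>n0. \<forall>d::nat. d \<ge> 2 \<longrightarrow>
      (\<forall>x. hard_ball_evolution n d x \<longrightarrow>
           no_simultaneous_collisions n d x \<longrightarrow>
           (\<forall>(j, k, t)\<in>collisions n d x. \<forall>l<n. \<forall>m<n. l \<noteq> m \<longrightarrow> {l, m} \<noteq> {j, k} \<longrightarrow>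
              ball_dist d x l m t > real n powr (- real n)) \<longrightarrow>
           finite (collisions n d x) \<and>
           real (card (collisions n d x)) \<le> real n powr (5 * real n / 2 + \<epsilon> * real n))"
  proof (intro exI allI impI)
    fix n d x
    \<comment> \<open>The threshold depends on \<open>\<epsilon>\<close> only. It makes
      \<open>n\<close> to the power \<open>\<epsilon>\<close> at least 17952, and the maximum with 1
      keeps \<open>n\<close> positive.\<close>
    assume n: "max 1 (nat \<lceil>17952 powr (1 / \<epsilon>)\<rceil>) \<le> n" and ev: "hard_ball_evolution n d x"
      and sep: "\<forall>(j, k, t)\<in>collisions n d x. \<forall>l<n. \<forall>m<n. l \<noteq> m \<longrightarrow> {l, m} \<noteq> {j, k} \<longrightarrow>
              ball_dist d x l m t > real n powr (- real n)"
    have n1: "1 \<le> n" and nb: "17952 powr (1 / \<epsilon>) \<le> real n" using n by (auto simp: nat_le_iff ceiling_le_iff)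
    interpret separated_evolution n d x "real n powr (- real n)"
    proof
      fix j k t l m
      assume h: "collide d x j k t" "j < n" "k < n" "l < n" "m < n" "l \<noteq> m" "{l, m} \<noteq> {j, k}"
      have "j \<noteq> k" using collide_imp_neq[OF h(1)] .
      \<comment> \<open>\<open>collisions\<close> lists sorted pairs, whereas the locale takes the
        colliding pair in any order.\<close>
      then have "(j, k, t) \<in> collisions n d x \<or> (k, j, t) \<in> collisions n d x"
        using h(1-3) collide_commute[of d x j k t] by (auto simp: collisions_def)
      then obtain p q where pq: "(p, q, t) \<in> collisions n d x" "{p, q} = {j, k}"
        by (metis insert_commute)
      then show "real n powr (- real n) < ball_dist d x l m t"
        using bspec[OF sep pq(1)] h(4-7) by simp
    qed (use ev n1 in auto)
    show "finite (collisions n d x) \<and>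
           real (card (collisions n d x)) \<le> real n powr (5 * real n / 2 + \<epsilon> * real n)"
      using collisions_bound bound_asymptotics[OF eps n1 nb] n1 by fastforce
  qed
qed

end
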